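(* Let $G$ be a finite group. Then $G \cong \mathrm{PSL}(2,7)$ if and only if $\operatorname{Exp}_{\rho}(G) = \operatorname{Exp}_{\rho}(\mathrm{PSL}(2,7))$.
   Context: For a finite group $G$, $o(g)$ denotes the order of $g\in G$ and $\rho(G)=\prod_{g\in G} o(g)$ is the product of the element orders. If $n=p_1^{\alpha_1}\cdots p_k^{\alpha_k}$ with $p_1,\dots,p_k$ distinct primes and all $\alpha_i\ge 1$, then $\operatorname{Exp}(n)=\{\alpha_1,\dots,\alpha_k\}$, regarded as a set (repetitions are not recorded, nor is which exponent belongs to which prime). Set $\operatorname{Exp}_{\rho}(G)=\operatorname{Exp}(\rho(G))$. *)

theory Defs
  imports
    "HOL-Algebra.Multiplicative_Group"
    "HOL-Analysis.Determinants"
    "HOL-Library.Numeral_Type"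
    "HOL-Computational_Algebra.Primes"
begin

definition exponent_set :: "nat \<Rightarrow> nat set" where
  "exponent_set n = (\<lambda>p. multiplicity p n) ` prime_factors n"

definition order_product :: "('a, 'b) monoid_scheme \<Rightarrow> nat" where
  "order_product G = (\<Prod>g\<in>carrier G. group.ord G g)"

definition Exp_rho :: "('a, 'b) monoid_scheme \<Rightarrow> nat set" where
  "Exp_rho G = exponent_set (order_product G)"

definition group_center :: "('a, 'b) monoid_scheme \<Rightarrow> 'a set" where
  "group_center G = {z \<in> carrier G. \<forall>g\<in>carrier G. z \<otimes>\<^bsub>G\<^esub> g = g \<otimes>\<^bsub>G\<^esub> z}"

definition SL :: "('a::comm_ring_1 ^ 'n ^ 'n) monoid" where
  "SL = \<lparr>carrier = {A. det A = 1}, monoid.mult = (\<lambda>A B. A ** B), one = mat 1\<rparr>"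

definition PSL :: "('a::comm_ring_1 ^ 'n ^ 'n) set monoid" where
  "PSL = SL Mod group_center SL"

(* The numeral type 7 is the ring of integers modulo 7 (without a field instance in the library,
   which is why SL and PSL are set up over commutative rings), the numeral type 2 is the
   two-element index type. *)
definition PSL_2_7 :: "(7 ^ 2 ^ 2) set monoid" where
  "PSL_2_7 = PSL"

end

theory Submission
  imports Defs "HOL-Algebra.Group_Action" "HOL-Algebra.Sylow" "HOL-Number_Theory.Cong"
begin

text \<open>For a prime \<open>p\<close> let \<open>E p\<close> be the exponent of \<open>p\<close> in \<open>\<rho>(G)\<close>, so that \<open>E p\<close> is the sum of the
  \<open>p\<close>-adic valuations of the element orders. Sorting the elements by their \<open>q\<close>'-part and using
  Frobenius' theorem on the number of \<open>q\<close>-elements in centralizers shows that the full power of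
  every prime \<open>q \<noteq> p\<close> in \<open>|G|\<close> divides \<open>E p\<close>. If the values are \<open>48, 56, 105\<close>, this forces
  \<open>E 7 = 48\<close>, \<open>E 3 = 56\<close> and \<open>|G| \<in> {42, 84, 168}\<close>: there are 48 elements of order divisible by 7
  and 56 elements of order divisible by 3. Hence there are 1 or 8 subgroups of order 7. In the first
  case the centralizer of that subgroup has order 56 and index 3, which produces at least 112
  elements of order divisible by 3. In the second case \<open>G\<close> acts faithfully and 2-transitively
  on the 8 subgroups; identifying them with the projective line over the field with 7 elements,
  \<open>G\<close> is generated by the maps \<open>z + 1\<close>, \<open>2 z\<close> and \<open>-1 / z\<close>. The same applies to
  \<open>PSL(2, 7)\<close>, whose element orders are read off from traces.\<close>

section \<open>Divisibility of the exponents\<close>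

text \<open>The set \<open>Exp_rho G\<close> hides which prime owns which exponent and even how many
  primes there are, and nothing is known about |G|. That \<open>E p\<close> is a multiple of the
  full q-part of |G| repairs this, because 48 and 56 have only the prime divisors 2, 3 and 2, 7. The
  values come from the 21, 56, 42 and 48 elements of order 2, 3, 4 and 7 in PSL(2,7): 105 = 21 + 2 *
  42, as order 4 counts twice.

  The counts 48 and 56 turn out to be saturated: eight subgroups of order 7 already supply 6 * 8
  elements, and the stabilizers of the 28 pairs of such subgroups supply 2 * 28. So orders such as
  21 and 6 do not occur, which is what controls the stabilizers and the elements swapping two
  points. Such a swap acts as c / z; the constant c can be normalised to -1 because involutions have
  no fixed points.\<close>

definition centralizer :: "('a, 'b) monoid_scheme \<Rightarrow> 'a \<Rightarrow> 'a set" where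
  "centralizer G x = {g \<in> carrier G. g \<otimes>\<^bsub>G\<^esub> x = x \<otimes>\<^bsub>G\<^esub> g}"

definition primary_elements :: "nat \<Rightarrow> ('a, 'b) monoid_scheme \<Rightarrow> 'a set" where
  "primary_elements q G = {u \<in> carrier G. \<exists>k. u [^]\<^bsub>G\<^esub> (q ^ k) = \<one>\<^bsub>G\<^esub>}"

text \<open>The invariant function is constant on orbits, so every orbit contributes its length
  times a single value.\<close>

lemma (in group_action) dvd_sum_orbits:
  fixes F :: "'c \<Rightarrow> nat"
  assumes "finite E"
    and inv: "\<And>g x. g \<in> carrier G \<Longrightarrow> x \<in> E \<Longrightarrow> F (\<phi> g x) = F x"
    and dvd: "\<And>x. x \<in> E \<Longrightarrow> d dvd card (orbit G \<phi> x) * F x"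
  shows "d dvd (\<Sum>x\<in>E. F x)"
proof -
  have "d dvd (\<Sum>x\<in>orb. F x)" if orb: "orb \<in> orbits G E \<phi>" for orb
  proof -
    obtain x where x: "x \<in> E" "orb = orbit G \<phi> x"
      using orb by (auto simp: orbits_def)
    have "F y = F x" if "y \<in> orb" for y
      using that x inv by (auto simp: orbit_def)
    then show ?thesis using dvd[OF x(1)] x(2) by simp
  qed
  then show ?thesis
    unfolding disjoint_sum[OF \<open>finite E\<close>, symmetric] by (rule dvd_sum)
qed

section \<open>Conjugation, centralizers and sorting by q'-parts\<close>

context group
begin

lemma stabilizer_conjugation:
  assumes "x \<in> carrier G"
  shows "stabilizer G (\<lambda>g. (\<lambda>h \<in> carrier G. g \<otimes> h \<otimes> inv g)) x = centralizer G x"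
  using assms by (auto simp: stabilizer_def centralizer_def inv_solve_right' inv_solve_right)

lemma centralizer_subgroup:
  assumes "x \<in> carrier G"
  shows "subgroup (centralizer G x) G"
  using group_action.stabilizer_subgroup[OF action_by_conjugation assms]
    stabilizer_conjugation[OF assms] by simp

lemma group_centralizer:
  assumes "x \<in> carrier G"
  shows "group (G\<lparr>carrier := centralizer G x\<rparr>)"
  using subgroup_imp_group[OF centralizer_subgroup[OF assms]] .

lemma inv_mult_cancel_left [simp]:
  assumes "g \<in> carrier G" "x \<in> carrier G"
  shows "inv g \<otimes> (g \<otimes> x) = x" "g \<otimes> (inv g \<otimes> x) = x"
  using assms by (simp_all flip: m_assoc)

lemma commute_inv:
  assumes "g \<in> carrier G" "y \<in> carrier G" "g \<otimes> y = y \<otimes> g"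
  shows "g \<otimes> inv y = inv y \<otimes> g"
proof -
  have "inv y \<otimes> (g \<otimes> y) \<otimes> inv y = inv y \<otimes> (y \<otimes> g) \<otimes> inv y" using assms(3) by simp
  then show ?thesis using assms(1,2) by (simp add: m_assoc)
qed

lemma pow_cong:
  fixes i j n :: nat
  assumes "g \<in> carrier G" "g [^] n = \<one>" "[i = j] (mod n)"
  shows "g [^] i = g [^] j"
proof -
  have "[int i = int j] (mod int n)" using assms(3) by (simp add: cong_int_iff)
  then have "int n dvd int j - int i" by (metis cong_iff_dvd_diff cong_sym)
  moreover have "int (ord g) dvd int n" using assms(1,2) pow_eq_id by simp
  ultimately have "g [^] int i = g [^] int j" using int_pow_eq[OF assms(1)] dvd_trans by blast
  then show ?thesis by (simp add: int_pow_int)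
qed

lemma mem_centralizer_conj:
  assumes "x \<in> carrier G" "g \<in> carrier G" "h \<in> carrier G"
  shows "g \<otimes> h \<otimes> inv g \<in> centralizer G (g \<otimes> x \<otimes> inv g) \<longleftrightarrow> h \<in> centralizer G x"
proof -
  have conj: "(g \<otimes> a \<otimes> inv g) \<otimes> (g \<otimes> b \<otimes> inv g) = g \<otimes> (a \<otimes> b) \<otimes> inv g"
    if "a \<in> carrier G" "b \<in> carrier G" for a b
    using that assms by (simp add: m_assoc)
  show ?thesis
    using assms by (auto simp: centralizer_def conj)
qed

lemma conj_pow:
  assumes "g \<in> carrier G" "x \<in> carrier G"
  shows "(g \<otimes> x \<otimes> inv g) [^] (n::nat) = g \<otimes> x [^] n \<otimes> inv g"
proof (induction n)
  case 0
  then show ?case using assms by simp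
next
  case (Suc n)
  then show ?case using assms by (simp add: m_assoc)
qed

lemma conj_eq_one_iff:
  assumes "g \<in> carrier G" "x \<in> carrier G"
  shows "g \<otimes> x \<otimes> inv g = \<one> \<longleftrightarrow> x = \<one>"
  using assms by (metis conjugation_is_inj one_closed r_inv r_one)

lemma ord_conj:
  assumes "g \<in> carrier G" "x \<in> carrier G"
  shows "ord (g \<otimes> x \<otimes> inv g) = ord x"
  using assms by (subst ord_unique) (auto simp: conj_pow conj_eq_one_iff pow_eq_id)

text \<open>For transporting cardinalities along conjugation: \<open>S\<close> and \<open>T\<close>
  will be the centralizers of x and of its conjugate, or their q-elements.\<close>

lemma bij_betw_conj:
  assumes "g \<in> carrier G" "S \<subseteq> carrier G" "T \<subseteq> carrier G"
    "\<And>h. h \<in> carrier G \<Longrightarrow> g \<otimes> h \<otimes> inv g \<in> T \<longleftrightarrow> h \<in> S"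
  shows "bij_betw (\<lambda>h. g \<otimes> h \<otimes> inv g) S T"
proof (rule bij_betw_imageI)
  show "inj_on (\<lambda>h. g \<otimes> h \<otimes> inv g) S"
    using assms(1,2) by (meson conjugation_is_inj inj_onI subsetD)
  show "(\<lambda>h. g \<otimes> h \<otimes> inv g) ` S = T"
  proof
    show "(\<lambda>h. g \<otimes> h \<otimes> inv g) ` S \<subseteq> T" using assms by auto
    show "T \<subseteq> (\<lambda>h. g \<otimes> h \<otimes> inv g) ` S"
    proof
      fix y assume y: "y \<in> T"
      then have "y = g \<otimes> (inv g \<otimes> y \<otimes> g) \<otimes> inv g"
        using assms by (metis conjugation_is_surj subsetD)
      moreover have "inv g \<otimes> y \<otimes> g \<in> carrier G" using y assms by auto
      ultimately show "y \<in> (\<lambda>h. g \<otimes> h \<otimes> inv g) ` S"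
        using assms(4) y by (metis imageI)
    qed
  qed
qed

lemma card_centralizer_conj:
  assumes "x \<in> carrier G" "g \<in> carrier G"
  shows "card (centralizer G (g \<otimes> x \<otimes> inv g)) = card (centralizer G x)"
  by (rule bij_betw_same_card[OF bij_betw_conj[OF assms(2)], symmetric])
     (use assms mem_centralizer_conj in \<open>auto simp: centralizer_def\<close>)

text \<open>Lets Frobenius' theorem for the centralizer, as a group of its own, be read as a count
  inside G.\<close>

lemma primary_elements_centralizer:
  "primary_elements q (G\<lparr>carrier := centralizer G x\<rparr>) = primary_elements q G \<inter> centralizer G x"
  by (auto simp: primary_elements_def centralizer_def nat_pow_consistent[symmetric])

lemma primary_elements_conj:
  assumes "g \<in> carrier G" "h \<in> carrier G"
  shows "g \<otimes> h \<otimes> inv g \<in> primary_elements q G \<longleftrightarrow> h \<in> primary_elements q G"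
  using assms by (simp add: primary_elements_def conj_pow conj_eq_one_iff)

lemma card_primary_centralizer_conj:
  assumes "x \<in> carrier G" "g \<in> carrier G"
  shows "card (primary_elements q G \<inter> centralizer G (g \<otimes> x \<otimes> inv g))
       = card (primary_elements q G \<inter> centralizer G x)"
  by (rule bij_betw_same_card[OF bij_betw_conj[OF assms(2)], symmetric])
     (use assms mem_centralizer_conj primary_elements_conj in \<open>auto simp: centralizer_def\<close>)

text \<open>The order of u is a power of q dividing q^b m, hence prime to m.\<close>

lemma primary_element_pow:
  assumes "u \<in> primary_elements q G" "prime q" "order G = q ^ b * m" "finite (carrier G)"
    "\<not> q dvd m"
  shows "u [^] (q ^ b) = \<one>"
proof -
  obtain k where u: "u \<in> carrier G" "u [^] (q ^ k) = \<one>"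
    using assms(1) by (auto simp: primary_elements_def)
  then have "ord u dvd q ^ k" "ord u dvd q ^ b * m"
    using pow_eq_id ord_dvd_group_order assms(3) by auto
  then obtain j where j: "ord u = q ^ j" using assms(2) divides_primepow_nat by blast
  then have "coprime (ord u) m"
    using assms(2,5) by (simp add: prime_imp_coprime)
  then have "ord u dvd q ^ b"
    using \<open>ord u dvd q ^ b * m\<close> coprime_dvd_mult_left_iff by blast
  then show ?thesis using u pow_eq_id by blast
qed

text \<open>The map \<open>g \<mapsto> g ^ e\<close> below extracts the \<open>q'\<close>-part of \<open>g\<close>.\<close>

lemma prime_part_fibre:
  assumes "prime q" "order G = q ^ b * m" "finite (carrier G)" "\<not> q dvd m"
    and e: "[e = 0] (mod q ^ b)" "[e = 1] (mod m)"
    and y: "y \<in> carrier G" "y [^] m = \<one>"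
  shows "card {g \<in> carrier G. g [^] e = y} = card (primary_elements q G \<inter> centralizer G y)"
proof -
  \<comment> \<open>Multiplication by y pairs the q-elements commuting with y with the elements
    whose q'-part is y; dividing by y leaves the q-part.\<close>
  have "bij_betw (\<lambda>u. u \<otimes> y) (primary_elements q G \<inter> centralizer G y) {g \<in> carrier G. g [^] e = y}"
  proof (rule bij_betwI[where g = "\<lambda>g. g \<otimes> inv y"])
    show "(\<lambda>u. u \<otimes> y) \<in> primary_elements q G \<inter> centralizer G y \<rightarrow> {g \<in> carrier G. g [^] e = y}"
    proof
      fix u assume u: "u \<in> primary_elements q G \<inter> centralizer G y"
      then have uc: "u \<in> carrier G" "u \<otimes> y = y \<otimes> u" by (auto simp: centralizer_def)
      have "u [^] e = \<one>"
        using pow_cong[of u "q ^ b" e 0] primary_element_pow[of u q b m] u uc e assms by simp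
      moreover have "y [^] e = y"
        using pow_cong[of y m e 1] y e by simp
      ultimately show "u \<otimes> y \<in> {g \<in> carrier G. g [^] e = y}"
        using uc y by (simp add: pow_mult_distrib)
    qed
    show "(\<lambda>g. g \<otimes> inv y) \<in> {g \<in> carrier G. g [^] e = y} \<rightarrow> primary_elements q G \<inter> centralizer G y"
    proof
      fix g assume "g \<in> {g \<in> carrier G. g [^] e = y}"
      then have g: "g \<in> carrier G" "g [^] e = y" by auto
      have comm: "g \<otimes> y = y \<otimes> g" using g
        by (metis group_commutes_pow)
      then have comm': "g \<otimes> inv y = inv y \<otimes> g"
        using g(1) y(1) by (rule_tac commute_inv)
      \<comment> \<open>As e is 1 modulo m, the exponents e q^b and q^b agree modulo |G|. Hence y
        and g have equal q^b-th powers, and their quotient is a q-element because they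
        commute.\<close>
      have "[e * q ^ b = q ^ b] (mod q ^ b * m)"
        using cong_cmult_leftI[OF e(2), of "q ^ b"] by (simp add: mult.commute)
      then have "g [^] (e * q ^ b) = g [^] (q ^ b)"
        using pow_cong[of g "q ^ b * m"] g pow_order_eq_1 assms(2) by metis
      then have "y [^] (q ^ b) = g [^] (q ^ b)"
        using g by (metis nat_pow_pow)
      then have "(g \<otimes> inv y) [^] (q ^ b) = \<one>"
        using comm' g(1) y(1) by (simp add: pow_mult_distrib nat_pow_inv)
      moreover have "g \<otimes> inv y \<otimes> y = y \<otimes> (g \<otimes> inv y)"
      proof -
        have "g \<otimes> inv y \<otimes> y = g" using g(1) y(1) by (simp add: m_assoc)
        moreover have "y \<otimes> (g \<otimes> inv y) = g" using g(1) y(1) by (simp add: comm')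
        ultimately show ?thesis by simp
      qed
      ultimately show "g \<otimes> inv y \<in> primary_elements q G \<inter> centralizer G y"
        using g(1) y(1) by (auto simp: primary_elements_def centralizer_def)
    qed
  qed (use y in \<open>auto simp: primary_elements_def m_assoc\<close>)
  then show ?thesis by (metis bij_betw_same_card)
qed

text \<open>The powers g^e satisfy y^m = 1 because q^b divides e. \<open>f\<close> is constant on
  each fibre, whose size is the number of q-elements commuting with y. Used with \<open>f\<close> =
  1 for counting and with \<open>f\<close> the p-adic valuation of the order.\<close>

lemma sum_prime_part:
  fixes f :: "'a \<Rightarrow> nat"
  assumes "prime q" "order G = q ^ b * m" "finite (carrier G)" "\<not> q dvd m"
    and e: "[e = 0] (mod q ^ b)" "[e = 1] (mod m)"
    and f: "\<And>g. g \<in> carrier G \<Longrightarrow> f (g [^] e) = f g"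
  shows "(\<Sum>g\<in>carrier G. f g) =
    (\<Sum>y\<in>{y \<in> carrier G. y [^] m = \<one>}. f y * card (primary_elements q G \<inter> centralizer G y))"
proof -
  have "(g [^] e) [^] m = \<one>" if "g \<in> carrier G" for g
  proof -
    obtain k where "e = q ^ b * k" using e(1) by (auto simp: cong_0_iff)
    then have "(g [^] e) [^] m = (g [^] order G) [^] k"
      using that assms(2) by (simp add: nat_pow_pow mult_ac)
    then show ?thesis using that by (simp add: pow_order_eq_1)
  qed
  then have "(\<Sum>g\<in>carrier G. f g) =
    (\<Sum>y\<in>{y \<in> carrier G. y [^] m = \<one>}. \<Sum>g\<in>{g \<in> carrier G. g [^] e = y}. f g)"
    using assms(3) by (intro sum.group[symmetric]) auto
  also have "\<dots> = (\<Sum>y\<in>{y \<in> carrier G. y [^] m = \<one>}. f y * card (primary_elements q G \<inter> centralizer G y))"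
  proof (rule sum.cong[OF refl])
    fix y assume y: "y \<in> {y \<in> carrier G. y [^] m = \<one>}"
    have "(\<Sum>g\<in>{g \<in> carrier G. g [^] e = y}. f g) = (\<Sum>g\<in>{g \<in> carrier G. g [^] e = y}. f y)"
      using f by (intro sum.cong) auto
    then show "(\<Sum>g\<in>{g \<in> carrier G. g [^] e = y}. f g)
      = f y * card (primary_elements q G \<inter> centralizer G y)"
      using prime_part_fibre[OF assms(1-4) e] y by simp
  qed
  finally show ?thesis .
qed

text \<open>The class of y has length |G| / |C(y)|, so it supplies exactly the power of q that
  |C(y)| lacks compared with |G|.\<close>

lemma orbit_conjugation_dvd:
  assumes fin: "finite (carrier G)" and q: "prime q" and y: "y \<in> carrier G"
    and dvd: "q ^ multiplicity q (card (centralizer G y)) dvd c"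
  shows "q ^ multiplicity q (order G) dvd
    card (orbit G (\<lambda>g. (\<lambda>h \<in> carrier G. g \<otimes> h \<otimes> inv g)) y) * c"
proof -
  let ?o = "card (orbit G (\<lambda>g. (\<lambda>h \<in> carrier G. g \<otimes> h \<otimes> inv g)) y)"
  have eq: "?o * card (centralizer G y) = order G"
    using group_action.orbit_stabilizer_theorem[OF action_by_conjugation y]
      stabilizer_conjugation[OF y] by simp
  have "order G \<noteq> 0" using fin by (simp add: order_gt_0_iff_finite[THEN iffD2, OF fin])
  then have nz: "?o \<noteq> 0" "card (centralizer G y) \<noteq> 0" using eq by (metis mult_0, metis mult_0_right)
  have "multiplicity q (order G) = multiplicity q ?o + multiplicity q (card (centralizer G y))"
    unfolding eq[symmetric] using q nz by (intro prime_elem_multiplicity_mult_distrib) auto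
  then show ?thesis
    using dvd by (simp add: power_add mult_dvd_mono multiplicity_dvd)
qed

text \<open>The common mechanism of Frobenius' theorem and of the divisibility of the exponents: in
  both, \<open>F y\<close> is a weight times the number of q-elements of the centralizer of
  y.\<close>

lemma prime_power_dvd_sum_conjugation:
  fixes F :: "'a \<Rightarrow> nat"
  assumes fin: "finite (carrier G)" and q: "prime q"
    and F: "\<And>g y. g \<in> carrier G \<Longrightarrow> y \<in> carrier G \<Longrightarrow> F (g \<otimes> y \<otimes> inv g) = F y"
    and dvd: "\<And>y. y \<in> carrier G \<Longrightarrow> q ^ multiplicity q (card (centralizer G y)) dvd F y"
  shows "q ^ multiplicity q (order G) dvd (\<Sum>y\<in>carrier G. F y)"
  by (rule group_action.dvd_sum_orbits[OF action_by_conjugation fin])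
     (use F orbit_conjugation_dvd[OF fin q] dvd in auto)

end

section \<open>Frobenius' theorem on the number of q-elements\<close>

lemma order_prime_split:
  assumes "n > (0::nat)" "prime q"
  obtains m where "n = q ^ multiplicity q n * m" "\<not> q dvd m"
  using assms by (metis multiplicity_decompose' not_gr0 not_prime_unit)

lemma obtain_prime_part_exponent:
  assumes "prime q" "\<not> q dvd m"
  obtains e :: nat where "[e = 0] (mod q ^ b)" "[e = 1] (mod m)"
proof -
  have "coprime (q ^ b) m" using assms by (simp add: prime_imp_coprime)
  then obtain x where "[q ^ b * x = 1] (mod m)" using cong_solve_coprime_nat by (metis One_nat_def)
  then show ?thesis by (intro that[of "q ^ b * x"]) (auto simp: cong_0_iff)
qed

text \<open>A special case of a theorem of Frobenius. Splitting off the \<open>q'\<close>-part of every element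
  expresses the order of the group through the numbers for the centralizers; only the central
  \<open>q'\<close>-elements, whose number is prime to \<open>q\<close>, escape the induction hypothesis.\<close>

theorem card_primary_elements_dvd:
  assumes "group G" "finite (carrier G)" "prime q"
  shows "q ^ multiplicity q (order G) dvd card (primary_elements q G)"
  using assms
proof (induction "order G" arbitrary: G rule: less_induct)
  case less
  interpret group G by fact
  note fin = less.prems(2) and q = less.prems(3)
  let ?b = "multiplicity q (order G)"
  have pos: "order G > 0" using fin order_gt_0_iff_finite by blast
  then obtain m where m: "order G = q ^ ?b * m" "\<not> q dvd m"
    using q order_prime_split by blast
  obtain e where e: "[e = 0] (mod q ^ ?b)" "[e = 1] (mod m)"
    using obtain_prime_part_exponent[OF q m(2)] by blast
  let ?S = "{y \<in> carrier G. y [^]\<^bsub>G\<^esub> m = \<one>\<^bsub>G\<^esub>}"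
  let ?N = "\<lambda>y. card (primary_elements q G \<inter> centralizer G y)"
  let ?Z = "{y \<in> ?S. centralizer G y = carrier G}"
  \<comment> \<open>Central y are masked out: their centralizer is G itself, to which the induction
    hypothesis does not apply.\<close>
  define F where "F y = (if y \<in> ?S - ?Z then ?N y else 0)" for y
  have dF: "q ^ ?b dvd (\<Sum>y\<in>carrier G. F y)"
  proof (rule prime_power_dvd_sum_conjugation[OF fin q])
    fix g y assume gy: "g \<in> carrier G" "y \<in> carrier G"
    \<comment> \<open>Being central is expressed by a cardinality, so that its invariance under
      conjugation follows from that of the order of the centralizer.\<close>
    have "centralizer G x = carrier G \<longleftrightarrow> card (centralizer G x) = card (carrier G)" for x
      using card_subset_eq[OF fin, of "centralizer G x"] by (auto simp: centralizer_def)
    then show "F (g \<otimes>\<^bsub>G\<^esub> y \<otimes>\<^bsub>G\<^esub> inv\<^bsub>G\<^esub> g) = F y"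
      using gy by (simp add: F_def conj_pow conj_eq_one_iff card_primary_centralizer_conj card_centralizer_conj)
  next
    fix y assume y: "y \<in> carrier G"
    show "q ^ multiplicity q (card (centralizer G y)) dvd F y"
    proof (cases "y \<in> ?S - ?Z")
      case True
      then have "centralizer G y \<subset> carrier G" by (auto simp: centralizer_def)
      then have "order (G\<lparr>carrier := centralizer G y\<rparr>) < order G"
        using fin by (simp add: order_def psubset_card_mono)
      then show ?thesis
        using less.hyps[OF _ group_centralizer[OF y] _ q] fin True
          finite_subset[OF subgroup.subset[OF centralizer_subgroup[OF y]] fin]
        by (simp add: F_def primary_elements_centralizer order_def)
    next
      case False
      show ?thesis unfolding F_def if_not_P[OF False] by (rule dvd_0_right)
    qed
  qed
  have "order G = card ?Z * card (primary_elements q G) + (\<Sum>y\<in>carrier G. F y)"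
  proof -
    have "order G = (\<Sum>y\<in>?S. ?N y)"
      using sum_prime_part[OF q m(1) fin m(2) e, of "\<lambda>_. 1"] by (simp add: order_def)
    also have "\<dots> = (\<Sum>y\<in>?Z. ?N y) + (\<Sum>y\<in>?S - ?Z. ?N y)"
      using fin by (subst sum.subset_diff[of ?Z ?S]) auto
    also have "(\<Sum>y\<in>?S - ?Z. ?N y) = (\<Sum>y\<in>carrier G. F y)"
      using fin by (intro sum.mono_neutral_cong_left) (auto simp: F_def)
    also have "(\<Sum>y\<in>?Z. ?N y) = (\<Sum>y\<in>?Z. card (primary_elements q G))"
      by (intro sum.cong refl arg_cong[of _ _ card]) (auto simp: primary_elements_def)
    finally show ?thesis by simp
  qed
  then have dZ: "q ^ ?b dvd card ?Z * card (primary_elements q G)"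
    using dvd_add_left_iff[OF dF, of "card ?Z * card (primary_elements q G)"]
      multiplicity_dvd[of q "order G"] by simp
  \<comment> \<open>The central elements with y^m = 1 form a subgroup. If q divided its order,
    Sylow's theorem with exponent 1 would give a nontrivial element whose order divides both q and
    m.\<close>
  have "\<not> q dvd card ?Z"
  proof
    assume "q dvd card ?Z"
    have comm: "y \<in> ?Z \<longleftrightarrow> y \<in> carrier G \<and> y [^]\<^bsub>G\<^esub> m = \<one>\<^bsub>G\<^esub> \<and> (\<forall>g\<in>carrier G. g \<otimes>\<^bsub>G\<^esub> y = y \<otimes>\<^bsub>G\<^esub> g)" for y
      by (auto simp: centralizer_def)
    have Z: "subgroup ?Z G"
    proof
      show "?Z \<subseteq> carrier G" by auto
      show "\<one>\<^bsub>G\<^esub> \<in> ?Z" by (auto simp: centralizer_def)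
      fix x y assume "x \<in> ?Z" "y \<in> ?Z"
      then have xy: "x \<in> carrier G" "y \<in> carrier G" "x [^]\<^bsub>G\<^esub> m = \<one>\<^bsub>G\<^esub>" "y [^]\<^bsub>G\<^esub> m = \<one>\<^bsub>G\<^esub>"
        and cm: "\<And>g. g \<in> carrier G \<Longrightarrow> g \<otimes>\<^bsub>G\<^esub> x = x \<otimes>\<^bsub>G\<^esub> g" "\<And>g. g \<in> carrier G \<Longrightarrow> g \<otimes>\<^bsub>G\<^esub> y = y \<otimes>\<^bsub>G\<^esub> g"
        unfolding comm by auto
      have "g \<otimes>\<^bsub>G\<^esub> (x \<otimes>\<^bsub>G\<^esub> y) = (x \<otimes>\<^bsub>G\<^esub> y) \<otimes>\<^bsub>G\<^esub> g" if g: "g \<in> carrier G" for g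
      proof -
        have "g \<otimes>\<^bsub>G\<^esub> (x \<otimes>\<^bsub>G\<^esub> y) = x \<otimes>\<^bsub>G\<^esub> g \<otimes>\<^bsub>G\<^esub> y"
          using xy g by (simp flip: m_assoc add: cm(1))
        also have "\<dots> = x \<otimes>\<^bsub>G\<^esub> y \<otimes>\<^bsub>G\<^esub> g"
          using xy g cm(2) by (simp add: m_assoc)
        finally show ?thesis .
      qed
      moreover have "(x \<otimes>\<^bsub>G\<^esub> y) [^]\<^bsub>G\<^esub> m = \<one>\<^bsub>G\<^esub>"
        using xy cm(2) by (simp add: pow_mult_distrib)
      ultimately show "x \<otimes>\<^bsub>G\<^esub> y \<in> ?Z" using xy unfolding comm by blast
    next
      fix x assume "x \<in> ?Z"
      then show "inv\<^bsub>G\<^esub> x \<in> ?Z" unfolding comm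
        by (auto simp: nat_pow_inv commute_inv)
    qed
    interpret Z: group "G\<lparr>carrier := ?Z\<rparr>" using subgroup_imp_group[OF Z] .
    obtain k where "card ?Z = q ^ 1 * k" using \<open>q dvd card ?Z\<close> by auto
    then obtain H where H: "subgroup H (G\<lparr>carrier := ?Z\<rparr>)" "card H = q ^ 1"
      using sylow_thm[OF q Z.group_axioms, of 1 k] fin by (auto simp: order_def)
    then have "H \<noteq> {\<one>\<^bsub>G\<^esub>}" using q by auto
    moreover have "\<one>\<^bsub>G\<^esub> \<in> H" using subgroup.one_closed[OF H(1)] by simp
    ultimately obtain u where u: "u \<in> H" "u \<noteq> \<one>\<^bsub>G\<^esub>" by auto
    have HG: "subgroup H G"
      using H(1) Z incl_subgroup by blast
    interpret H: group "G\<lparr>carrier := H\<rparr>" using subgroup_imp_group[OF HG] .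
    have "u [^]\<^bsub>G\<^esub> q = \<one>\<^bsub>G\<^esub>"
      using H.pow_order_eq_1[of u] u H(2) by (simp add: order_def nat_pow_consistent[symmetric])
    moreover have "u [^]\<^bsub>G\<^esub> m = \<one>\<^bsub>G\<^esub>" "u \<in> carrier G"
      using u subgroup.subset[OF H(1)] by auto
    ultimately have "ord u dvd gcd q m" using pow_eq_id by auto
    moreover have "gcd q m = 1" using prime_imp_coprime[OF q m(2)] by (simp add: coprime_iff_gcd_eq_1)
    ultimately have "ord u = 1" by simp
    then show False using u \<open>u \<in> carrier G\<close> ord_eq_1 by blast
  qed
  then have "coprime (q ^ ?b) (card ?Z)"
    using prime_imp_coprime[OF q] by simp
  then show ?case using dZ coprime_dvd_mult_right_iff by blast
qed

section \<open>The exponents of the primes in the order product\<close>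

definition rho_exponent :: "nat \<Rightarrow> ('a, 'b) monoid_scheme \<Rightarrow> nat" where
  "rho_exponent p G = (\<Sum>g\<in>carrier G. multiplicity p (group.ord G g))"

context group
begin

lemma multiplicity_order_product:
  assumes "finite (carrier G)" "prime p"
  shows "multiplicity p (order_product G) = rho_exponent p G"
  unfolding order_product_def rho_exponent_def
proof (rule prime_elem_multiplicity_prod_distrib)
  show "0 \<notin> ord ` carrier G"
    using ord_ge_1[OF assms(1)] by fastforce
qed (use assms in auto)

text \<open>Since q differs from p, the p-adic valuation of the order of g depends only on the
  q'-part of g. Sorting then gives a sum of valuations weighted by numbers of q-elements in
  centralizers; Frobenius' theorem now applies to every y, central or not.\<close>

theorem prime_power_dvd_rho_exponent:
  assumes fin: "finite (carrier G)" and p: "prime p" and q: "prime q" "q \<noteq> p"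
  shows "q ^ multiplicity q (order G) dvd rho_exponent p G"
proof -
  let ?b = "multiplicity q (order G)"
  have pos: "order G > 0" using fin order_gt_0_iff_finite by blast
  then obtain m where m: "order G = q ^ ?b * m" "\<not> q dvd m"
    using q order_prime_split by blast
  obtain e where e: "[e = 0] (mod q ^ ?b)" "[e = 1] (mod m)"
    using obtain_prime_part_exponent[OF q(1) m(2)] by blast
  let ?f = "\<lambda>g. multiplicity p (ord g)"
  let ?S = "{y \<in> carrier G. y [^] m = \<one>}"
  have f: "?f (g [^] e) = ?f g" if g: "g \<in> carrier G" for g
  proof (cases "p dvd ord g")
    case False
    then have "\<not> p dvd ord (g [^] e)"
      using g by (metis dvd_trans nat_pow_closed nat_pow_pow pow_eq_id mult.commute nat_pow_one pow_ord_eq_1)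
    then show ?thesis using False by (simp add: not_dvd_imp_multiplicity_0)
  next
    case True
    then have "p dvd m"
      using ord_dvd_group_order[OF g] m(1) p q
      by (metis dvd_trans prime_dvd_mult_iff prime_dvd_power primes_dvd_imp_eq)
    \<comment> \<open>A prime p dividing both ord g and m sees e as 1, so raising to the e-th power
      keeps the p-part of the order.\<close>
    then have "[e = 1] (mod p)" using e(2) cong_dvd_modulus_nat by blast
    then have pe: "\<not> p dvd e" using p
      by (metis cong_dvd_iff not_prime_unit dvd_refl)
    then have "e \<noteq> 0" by (metis dvd_0_right)
    then have o: "ord g = ord (g [^] e) * gcd (ord g) e" using ord_pow_gen[OF g] by auto
    have nz: "ord g \<noteq> 0" using ord_ge_1[OF fin g] by simp
    have "multiplicity p (gcd (ord g) e) = 0"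
      using pe by (auto intro!: not_dvd_imp_multiplicity_0)
    moreover have "?f g = ?f (g [^] e) + multiplicity p (gcd (ord g) e)"
      using nz p o by (metis prime_elem_multiplicity_mult_distrib mult_eq_0_iff prime_imp_prime_elem)
    ultimately show ?thesis by simp
  qed
  define F where "F y = (if y \<in> ?S then ?f y * card (primary_elements q G \<inter> centralizer G y) else 0)" for y
  have "rho_exponent p G = (\<Sum>y\<in>?S. ?f y * card (primary_elements q G \<inter> centralizer G y))"
    unfolding rho_exponent_def using f by (intro sum_prime_part[OF q(1) m(1) fin m(2) e])
  also have "\<dots> = (\<Sum>y\<in>carrier G. F y)"
    using fin by (intro sum.mono_neutral_cong_left) (auto simp: F_def)
  finally have eq: "rho_exponent p G = (\<Sum>y\<in>carrier G. F y)" .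
  show ?thesis unfolding eq
  proof (rule prime_power_dvd_sum_conjugation[OF fin q(1)])
    fix g y assume gy: "g \<in> carrier G" "y \<in> carrier G"
    then show "F (g \<otimes> y \<otimes> inv g) = F y"
      by (simp add: F_def conj_pow conj_eq_one_iff card_primary_centralizer_conj ord_conj)
  next
    fix y assume y: "y \<in> carrier G"
    have "q ^ multiplicity q (card (centralizer G y)) dvd card (primary_elements q G \<inter> centralizer G y)"
      using card_primary_elements_dvd[OF group_centralizer[OF y] _ q(1)]
        finite_subset[OF subgroup.subset[OF centralizer_subgroup[OF y]] fin]
      by (simp add: primary_elements_centralizer order_def)
    then show "q ^ multiplicity q (card (centralizer G y)) dvd F y"
      by (simp add: F_def)
  qed
qed

end

section \<open>Elements of order divisible by 7 and 3\<close>

context group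
begin

text \<open>The order of the coset of u divides both ord u and the index. Used for elements outside
  a normal subgroup of index 3 and for elements of order 7 in the normalizer of a subgroup of order
  7.\<close>

lemma mem_normal_if_coprime_index:
  assumes H: "H \<lhd> G" and u: "u \<in> carrier G" and co: "coprime (ord u) (card (rcosets H))"
  shows "u \<in> H"
proof -
  interpret H: normal H G by fact
  interpret Q: group "G Mod H" by (rule H.factorgroup_is_group)
  have Hu: "H #> u \<in> carrier (G Mod H)" using u by (simp add: FactGroup_def rcosetsI H.subset)
  have "(H #> u) [^]\<^bsub>G Mod H\<^esub> ord u = H #> \<one>"
    using H.FactGroup_pow[OF u, of "ord u"] u by simp
  then have "Q.ord (H #> u) dvd ord u"
    using Q.pow_eq_id[OF Hu, of "ord u"] by (simp add: H.subset FactGroup_def)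
  moreover have "Q.ord (H #> u) dvd card (rcosets H)"
    using Q.ord_dvd_group_order[OF Hu] by (simp add: order_def FactGroup_def)
  ultimately have "Q.ord (H #> u) = 1" using co by (metis coprime_common_divisor_nat nat_dvd_1_iff_1 coprime_def)
  then have "H #> u = H" using Q.ord_eq_1[OF Hu] by (simp add: FactGroup_def)
  then show ?thesis using rcos_self[OF u H.subgroup_axioms] by simp
qed

end

section \<open>Counting elements and subgroups of prime order\<close>

context group
begin

lemma prime_subgroup_eq_generate:
  assumes "finite (carrier G)" "subgroup H G" "card H = p" "prime p" "u \<in> H" "u \<noteq> \<one>"
  shows "H = generate G {u}" "ord u = p"
proof -
  have uG: "u \<in> carrier G" using assms subgroup.subset by blast
  interpret H: group "G\<lparr>carrier := H\<rparr>" using subgroup_imp_group[OF assms(2)] .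
  have "u [^] p = \<one>"
    using H.pow_order_eq_1[of u] assms by (simp add: order_def nat_pow_consistent[symmetric])
  then have "ord u dvd p" using pow_eq_id uG by blast
  then show o: "ord u = p" using assms(4,6) uG ord_eq_1[OF uG] prime_nat_iff[of p] by blast
  have "generate G {u} \<subseteq> H" using assms(2,5) by (simp add: generate_subgroup_incl)
  moreover have "card (generate G {u}) = p" using generate_pow_card[OF uG] o by simp
  moreover have "finite H" using assms subgroup.subset finite_subset by blast
  ultimately show "H = generate G {u}" using assms(3) card_subset_eq[of H "generate G {u}"] by simp
qed

lemma generate_prime_order:
  assumes "u \<in> carrier G" "ord u = p" "prime p"
  shows "subgroup (generate G {u}) G" "card (generate G {u}) = p" "u \<in> generate G {u}"
  using assms generate_is_subgroup[of "{u}"] generate_pow_card[of u] generate.incl[of u "{u}"] by simp_all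

text \<open>Different subgroups of order p meet only in the identity, and each has p - 1
  generators.\<close>

lemma card_elements_prime_order:
  assumes fin: "finite (carrier G)" and p: "prime p"
  shows "card {g \<in> carrier G. ord g = p} = (p - 1) * card {H. subgroup H G \<and> card H = p}"
proof -
  let ?S = "{H. subgroup H G \<and> card H = p}"
  have p1: "p > 1" using p prime_gt_1_nat by blast
  have eq: "{g \<in> carrier G. ord g = p} = (\<Union>H\<in>?S. H - {\<one>})"
  proof
    show "{g \<in> carrier G. ord g = p} \<subseteq> (\<Union>H\<in>?S. H - {\<one>})"
    proof
      fix g assume g: "g \<in> {g \<in> carrier G. ord g = p}"
      then have "g \<noteq> \<one>" using p1 by auto
      then show "g \<in> (\<Union>H\<in>?S. H - {\<one>})"
        using g generate_prime_order[of g p] p by (intro UN_I[of "generate G {g}"]) auto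
    qed
    show "(\<Union>H\<in>?S. H - {\<one>}) \<subseteq> {g \<in> carrier G. ord g = p}"
    proof
      fix u assume "u \<in> (\<Union>H\<in>?S. H - {\<one>})"
      then obtain H where H: "subgroup H G" "card H = p" "u \<in> H" "u \<noteq> \<one>" by blast
      then show "u \<in> {g \<in> carrier G. ord g = p}"
        using prime_subgroup_eq_generate(2)[OF fin H(1,2) p H(3,4)] subgroup.subset[OF H(1)] by blast
    qed
  qed
  have "finite ?S"
    using fin by (intro finite_subset[of ?S "Pow (carrier G)"]) (auto dest: subgroup.subset)
  moreover have "finite H" if "H \<in> ?S" for H
    using that fin finite_subset subgroup.subset by blast
  moreover have "(H - {\<one>}) \<inter> (K - {\<one>}) = {}" if "H \<in> ?S" "K \<in> ?S" "H \<noteq> K" for H K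
  proof (rule ccontr)
    assume "(H - {\<one>}) \<inter> (K - {\<one>}) \<noteq> {}"
    then obtain u where u: "u \<in> H" "u \<in> K" "u \<noteq> \<one>" by blast
    have "H = generate G {u}" "K = generate G {u}"
      using prime_subgroup_eq_generate(1)[OF fin _ _ p] that(1,2) u by auto
    then show False using that(3) by simp
  qed
  ultimately have "card (\<Union>H\<in>?S. H - {\<one>}) = (\<Sum>H\<in>?S. card (H - {\<one>}))"
    by (intro card_UN_disjoint ballI impI) (simp_all only: finite_Diff)
  also have "\<dots> = (\<Sum>H\<in>?S. p - 1)"
    by (intro sum.cong refl) (auto simp: subgroup.one_closed card_Diff_singleton)
  finally show ?thesis using eq by simp
qed

text \<open>As p^2 does not divide |G|, the p-elements are the identity and the elements of order p;
  Frobenius' theorem makes their number divisible by p. The conclusion says that the number of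
  subgroups of order p is 1 modulo p.\<close>

lemma card_prime_subgroups_mod:
  assumes fin: "finite (carrier G)" and p: "prime p" and pd: "p dvd order G" "\<not> p ^ 2 dvd order G"
  shows "p dvd 1 + (p - 1) * card {H. subgroup H G \<and> card H = p}"
proof -
  have "primary_elements p G = insert \<one> {g \<in> carrier G. ord g = p}" (is "?L = ?R")
  proof (rule Set.set_eqI, rule iffI)
    fix u assume "u \<in> primary_elements p G"
    then obtain k where u: "u \<in> carrier G" "ord u dvd p ^ k"
      using pow_eq_id by (auto simp: primary_elements_def)
    then obtain j where j: "ord u = p ^ j" using p divides_primepow_nat by blast
    have "j < 2"
    proof (rule ccontr)
      assume "\<not> j < 2"
      then have "p ^ 2 dvd ord u" using j le_imp_power_dvd[of 2 j p] by simp
      then show False using dvd_trans[OF _ ord_dvd_group_order[OF u(1)]] pd(2) by blast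
    qed
    then have "j = 0 \<or> j = 1" by linarith
    then show "u \<in> insert \<one> {g \<in> carrier G. ord g = p}"
      using u j ord_eq_1 by auto
  next
    fix u assume "u \<in> insert \<one> {g \<in> carrier G. ord g = p}"
    then have "u \<in> carrier G" "u = \<one> \<or> ord u = p" by auto
    then have "u \<in> carrier G" "u [^] (p ^ 1) = \<one>" using pow_eq_id[of u p] by auto
    then show "u \<in> primary_elements p G"
      unfolding primary_elements_def by (intro CollectI conjI exI[of _ 1])
  qed
  moreover have "\<one> \<notin> {g \<in> carrier G. ord g = p}" using p by auto
  ultimately have "card (primary_elements p G) = 1 + (p - 1) * card {H. subgroup H G \<and> card H = p}"
    using fin card_elements_prime_order[OF fin p] by simp
  moreover have "p dvd p ^ multiplicity p (order G)"
  proof -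
    have "order G \<noteq> 0" using fin order_gt_0_iff_finite by simp
    then have "multiplicity p (order G) \<ge> 1"
      using pd(1) p by (intro multiplicity_geI) auto
    then show ?thesis using dvd_power[of "multiplicity p (order G)" p] by simp
  qed
  ultimately show ?thesis
    using card_primary_elements_dvd[OF group_axioms fin p] dvd_trans[of p "p ^ multiplicity p (order G)"] by simp
qed

text \<open>Without p^2 in |G| each valuation is 0 or 1, so the sum only counts.\<close>

lemma rho_exponent_eq_card:
  assumes fin: "finite (carrier G)" and p: "prime p" and pd: "\<not> p ^ 2 dvd order G"
  shows "rho_exponent p G = card {g \<in> carrier G. p dvd ord g}"
proof -
  have "multiplicity p (ord g) = (if p dvd ord g then 1 else 0)" if g: "g \<in> carrier G" for g
  proof (cases "p dvd ord g")
    case True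
    have "\<not> p ^ 2 dvd ord g" using pd dvd_trans[OF _ ord_dvd_group_order[OF g]] by blast
    then show ?thesis using True
      by (intro multiplicity_eqI) (auto simp: numeral_2_eq_2)
  qed (simp add: not_dvd_imp_multiplicity_0)
  then have "rho_exponent p G = (\<Sum>g\<in>carrier G. if p dvd ord g then 1 else 0)"
    by (simp add: rho_exponent_def)
  also have "\<dots> = card {g \<in> carrier G. p dvd ord g}"
    using fin by (simp add: sum.If_cases Int_def)
  finally show ?thesis .
qed

lemma dvd_order_if_dvd_order_product:
  assumes "finite (carrier G)" "prime p" "p dvd order_product G"
  shows "p dvd order G"
proof -
  obtain g where "g \<in> carrier G" "p dvd ord g"
    using assms by (auto simp: order_product_def prime_dvd_prod_iff)
  then show ?thesis using dvd_trans[OF _ ord_dvd_group_order[of g]] by blast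
qed

text \<open>Let p, q, r own 48, 56, 105. Each of these primes divides the exponents of the others,
  so q and r divide 48 = 2^4 * 3 while p and r divide 56 = 2^3 * 7. Being distinct, they are p = 7,
  q = 3, r = 2.\<close>

lemma Exp_rho_imp_order:
  assumes fin: "finite (carrier G)" and E: "Exp_rho G = {48, 56, 105}"
  shows "order G \<in> {42, 84, 168}" "rho_exponent 7 G = 48" "rho_exponent 3 G = 56"
proof -
  have ex: "\<exists>p. prime p \<and> p dvd order G \<and> rho_exponent p G = k" if k: "k \<in> Exp_rho G" for k
  proof -
    obtain p where p: "p \<in> prime_factors (order_product G)" "k = multiplicity p (order_product G)"
      using k by (auto simp: Exp_rho_def exponent_set_def)
    then have "prime p" "p dvd order_product G" by auto
    then show ?thesis
      using multiplicity_order_product[OF fin, of p] dvd_order_if_dvd_order_product[OF fin, of p] p(2)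
      by (intro exI[of _ p]) simp
  qed
  obtain p where p: "prime p" "p dvd order G" "rho_exponent p G = 48" using ex[of 48] E by auto
  obtain q where q: "prime q" "q dvd order G" "rho_exponent q G = 56" using ex[of 56] E by auto
  obtain r where r: "prime r" "r dvd order G" "rho_exponent r G = 105" using ex[of 105] E by auto
  have pos: "order G > 0" using fin order_gt_0_iff_finite by blast
  have dist: "p \<noteq> q" "p \<noteq> r" "q \<noteq> r" using p q r by auto
  have pw: "s ^ multiplicity s (order G) dvd rho_exponent t G" if "prime s" "prime t" "s \<noteq> t" for s t
    using prime_power_dvd_rho_exponent[OF fin that(2,1,3)] .
  have m0: "multiplicity s (order G) > 0" if "prime s" "s dvd order G" for s
  proof -
    have "multiplicity s (order G) \<ge> 1"
      using pos that by (intro multiplicity_geI) auto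
    then show ?thesis by simp
  qed
  have dv: "s dvd rho_exponent t G" if "prime s" "prime t" "s \<noteq> t" "s dvd order G" for s t
    using pw[OF that(1-3)] dvd_power[of "multiplicity s (order G)" s] m0[OF that(1,4)] dvd_trans by blast
  have p3: "prime (3::nat)" and p7: "prime (7::nat)" by (simp_all add: prime_nat_numeral_eq)
  have d48: "s \<in> {2, 3}" if "prime s" "s dvd 48" for s :: nat
  proof -
    have "s dvd 2 ^ 4 * 3" using that by simp
    then have "s dvd 2 \<or> s dvd 3" using that(1) prime_dvd_mult_iff prime_dvd_power by blast
    then show ?thesis using that(1) p3 two_is_prime_nat primes_dvd_imp_eq by blast
  qed
  have d56: "s \<in> {2, 7}" if "prime s" "s dvd 56" for s :: nat
  proof -
    have "s dvd 2 ^ 3 * 7" using that by simp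
    then have "s dvd 2 \<or> s dvd 7" using that(1) prime_dvd_mult_iff prime_dvd_power by blast
    then show ?thesis using that(1) p7 two_is_prime_nat primes_dvd_imp_eq by blast
  qed
  have "q \<in> {2, 3}" "r \<in> {2, 3}"
    using d48 dv[OF q(1) p(1)] dv[OF r(1) p(1)] p q r dist by auto
  moreover have "p \<in> {2, 7}" "r \<in> {2, 7}"
    using d56 dv[OF p(1) q(1)] dv[OF r(1) q(1)] p q r dist by auto
  ultimately have pqr: "p = 7" "q = 3" "r = 2" using dist by auto
  then show "rho_exponent 7 G = 48" "rho_exponent 3 G = 56" using p q by auto
  \<comment> \<open>Any further prime divisor of |G| would divide \<open>E 7\<close> = 48.\<close>
  have "s \<in> {2, 3, 7}" if "prime s" "s dvd order G" for s
  proof (cases "s = 7")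
    case False
    then show ?thesis using dv[OF that(1) p(1)] that d48[OF that(1)] p pqr by auto
  qed simp
  then have "prime_factors (order G) = {2, 3, 7}"
    using p q r pqr pos by (auto simp: prime_factors_dvd)
  then have n: "order G = 2 ^ multiplicity 2 (order G) * (3 ^ multiplicity 3 (order G) * 7 ^ multiplicity 7 (order G))"
    using prime_factorization_nat[OF pos] by simp
  \<comment> \<open>The 2-part is bounded through \<open>E 3\<close> = 56, which allows at most 8;
    \<open>E 7\<close> = 48 would allow 16.\<close>
  have pd: "3 ^ multiplicity 3 (order G) dvd (48::nat)" "7 ^ multiplicity 7 (order G) dvd (56::nat)"
    "2 ^ multiplicity 2 (order G) dvd (56::nat)"
    using pw[of 3 7] pw[of 7 3] pw[of 2 3] p q pqr p3 p7 by auto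
  have mpos: "multiplicity 3 (order G) > 0" "multiplicity 7 (order G) > 0" "multiplicity 2 (order G) > 0"
    using m0 p q r pqr by auto
  have small: "k \<le> j" if "(t::nat) ^ k dvd c" "\<not> t ^ Suc j dvd c" for t k j c
    using that by (metis not_less_eq_eq power_le_dvd)
  have "multiplicity 3 (order G) \<le> 1" by (rule small[OF pd(1)]) simp
  moreover have "multiplicity 7 (order G) \<le> 1" by (rule small[OF pd(2)]) simp
  moreover have "multiplicity 2 (order G) \<le> 3" by (rule small[OF pd(3)]) simp
  ultimately have "multiplicity 3 (order G) = 1" "multiplicity 7 (order G) = 1"
    "multiplicity 2 (order G) = 1 \<or> multiplicity 2 (order G) = 2 \<or> multiplicity 2 (order G) = 3"
    using mpos by linarith+
  then have "order G = 2 * (3 * 7) \<or> order G = 2 ^ 2 * (3 * 7) \<or> order G = 2 ^ 3 * (3 * 7)"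
    using n by (elim disjE) (simp_all only: power_one_right, blast+)
  then show "order G \<in> {42, 84, 168}" by simp
qed

text \<open>A power of any element of order divisible by 7 generates the unique subgroup P, so all
  48 such elements lie in the centralizer C of P. Sorting C by 7'-parts gives |C| = 7 |D|, where D
  collects the elements of order prime to 7; hence 6 |D| = 48 and |C| = 56. Then |G| = 168, C is
  normal of index 3, and all 112 elements outside C have order divisible by 3.\<close>

lemma unique_subgroup_order_7:
  assumes fin: "finite (carrier G)" and n: "order G \<in> {42, 84, 168}"
    and c7: "card {g \<in> carrier G. 7 dvd ord g} = 48"
    and c1: "card {H. subgroup H G \<and> card H = 7} = 1"
  shows "card {g \<in> carrier G. 3 dvd ord g} \<ge> 112"
proof -
  have p7: "prime (7::nat)" by (simp add: prime_nat_numeral_eq)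
  obtain m where m: "order G = 7 * m" "\<not> 7 dvd m" "m \<in> {6, 12, 24}"
    using n by (elim insertE emptyE) auto
  obtain P where PS: "{H. subgroup H G \<and> card H = 7} = {P}"
    using c1 by (meson card_1_singletonE)
  then have P: "subgroup P G" "card P = 7" by auto
  have uniq: "u \<in> P" if "u \<in> carrier G" "ord u = 7" for u
    using generate_prime_order[OF that p7] PS by auto
  have "P \<noteq> {\<one>}" using P(2) by auto
  then obtain x where x: "x \<in> P" "x \<noteq> \<one>" using subgroup.one_closed[OF P(1)] by blast
  have xG: "x \<in> carrier G" using x P subgroup.subset by blast
  have ordx: "ord u = 7" if "u \<in> P" "u \<noteq> \<one>" for u
    using prime_subgroup_eq_generate(2)[OF fin P p7 that] .
  have pow: "\<exists>k::nat. v = u [^] k" if "u \<in> P" "u \<noteq> \<one>" "v \<in> P" for u v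
  proof -
    have "u \<in> carrier G" using that P subgroup.subset by blast
    then show ?thesis
      using prime_subgroup_eq_generate(1)[OF fin P p7 that(1,2)] that(3)
        generate_pow_on_finite_carrier[OF fin] by auto
  qed
  let ?C = "centralizer G x"
  have C: "subgroup ?C G" using centralizer_subgroup[OF xG] .
  have comm: "g \<otimes> u = u \<otimes> g"
    if gv: "g \<in> carrier G" "v \<in> P" "v \<noteq> \<one>" "u \<in> P" "g \<otimes> v = v \<otimes> g" for g u v
  proof -
    obtain k :: nat where k: "u = v [^] k" using pow[OF gv(2,3,4)] by blast
    have "v \<in> carrier G" using gv(2) P subgroup.subset by blast
    then show ?thesis using group_commutes_pow[of v g k] gv k by simp
  qed
  have PC: "P \<subseteq> ?C"
  proof
    fix u assume u: "u \<in> P"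
    then obtain k :: nat where "u = x [^] k" using pow[OF x] by blast
    then show "u \<in> ?C" using group_commutes_pow[of x x k] xG by (simp add: centralizer_def)
  qed
  have in_C: "g \<in> ?C" if g: "g \<in> carrier G" "7 dvd ord g" for g
  proof -
    \<comment> \<open>|G| = 7 m with m prime to 7, so the m-th power of g has order exactly
      7.\<close>
    have ne: "g [^] m \<noteq> \<one>" using g m pow_eq_id dvd_trans by blast
    have "(g [^] m) [^] (7::nat) = \<one>" using g m pow_order_eq_1 by (simp add: nat_pow_pow mult.commute)
    then have "ord (g [^] m) dvd 7" using pow_eq_id[of "g [^] m"] g by simp
    moreover have "ord (g [^] m) \<noteq> 1" using ne g ord_eq_1[of "g [^] m"] by simp
    ultimately have "ord (g [^] m) = 7" using p7 prime_nat_iff by blast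
    then have "g [^] m \<in> P" using uniq g by simp
    moreover have "g \<otimes> g [^] m = g [^] m \<otimes> g" using g by (simp add: group_commutes_pow)
    ultimately have "g \<otimes> x = x \<otimes> g" using comm[OF g(1) _ ne x(1)] by simp
    then show ?thesis using g by (simp add: centralizer_def)
  qed
  interpret C: group "G\<lparr>carrier := ?C\<rparr>" using subgroup_imp_group[OF C] .
  have finC: "finite ?C" using fin C finite_subset subgroup.subset by blast
  have "card P dvd card ?C"
    using C.lagrange[OF subgroup_incl[OF P(1) C PC]]
    by (simp add: order_def) (metis dvd_triv_right)
  then obtain c where c: "card ?C = 7 * c" using P(2) by auto
  have dvdG: "card ?C dvd order G" unfolding lagrange[OF C, symmetric] by simp
  then have c7': "c dvd m" using c m by simp
  then have nc: "\<not> 7 dvd c" using m dvd_trans by blast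
  let ?D = "{g \<in> ?C. g [^] c = \<one>}"
  have CG: "g \<in> carrier G" if "g \<in> ?C" for g using that by (simp add: centralizer_def)
  have "card ?C = 7 * card ?D"
  proof -
    obtain e where e: "[e = 0] (mod 7 ^ 1)" "[e = 1] (mod c)"
      using obtain_prime_part_exponent[OF p7 nc] by blast
    \<comment> \<open>P is central in C and contains all elements of order 7, so the 7-elements
      commuting with y are the same for every y.\<close>
    have "primary_elements 7 (G\<lparr>carrier := ?C\<rparr>) \<inter> centralizer (G\<lparr>carrier := ?C\<rparr>) y = P"
      if y: "y \<in> ?C" for y
    proof
      show "P \<subseteq> primary_elements 7 (G\<lparr>carrier := ?C\<rparr>) \<inter> centralizer (G\<lparr>carrier := ?C\<rparr>) y"
      proof
        fix u assume u: "u \<in> P"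
        then have uC: "u \<in> ?C" using PC by blast
        have "u [^] (7 ^ 1::nat) = \<one>"
          using ordx[OF u] CG[OF uC] pow_ord_eq_1[of u] by (cases "u = \<one>") auto
        then have "u \<in> primary_elements 7 (G\<lparr>carrier := ?C\<rparr>)"
          unfolding primary_elements_def using uC
          by (auto simp: nat_pow_consistent[symmetric] simp del: power_one_right intro!: exI[of _ 1])
        moreover have "y \<otimes> u = u \<otimes> y"
          using y comm[OF CG[OF y] x u] by (simp add: centralizer_def)
        ultimately show "u \<in> primary_elements 7 (G\<lparr>carrier := ?C\<rparr>) \<inter> centralizer (G\<lparr>carrier := ?C\<rparr>) y"
          using uC by (simp add: centralizer_def[of "G\<lparr>carrier := ?C\<rparr>"])
      qed
      show "primary_elements 7 (G\<lparr>carrier := ?C\<rparr>) \<inter> centralizer (G\<lparr>carrier := ?C\<rparr>) y \<subseteq> P"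
      proof
        fix u assume "u \<in> primary_elements 7 (G\<lparr>carrier := ?C\<rparr>) \<inter> centralizer (G\<lparr>carrier := ?C\<rparr>) y"
        then have u: "u \<in> primary_elements 7 G" "u \<in> carrier G"
          using CG unfolding primary_elements_centralizer by auto
        have "u [^] ((7::nat) ^ 1) = \<one>"
          using primary_element_pow[OF u(1) p7 _ fin m(2), of 1] m(1) by simp
        then have "ord u dvd 7" using u pow_eq_id by simp
        then have "u = \<one> \<or> ord u = 7" using p7 u ord_eq_1 by (metis prime_nat_iff)
        then show "u \<in> P" using uniq u subgroup.one_closed[OF P(1)] by auto
      qed
    qed
    then have "(\<Sum>g\<in>?C. 1::nat) = (\<Sum>y\<in>{y \<in> ?C. y [^] c = \<one>}. 1 * card P)"
      using C.sum_prime_part[OF p7 _ _ nc e, of "\<lambda>_. 1"] c finC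
      by (simp add: order_def nat_pow_consistent[symmetric])
    then show ?thesis using P by simp
  qed
  moreover have "{g \<in> carrier G. 7 dvd ord g} = ?C - ?D"
  proof (rule Set.set_eqI, rule iffI)
    fix g assume "g \<in> {g \<in> carrier G. 7 dvd ord g}"
    then show "g \<in> ?C - ?D" using in_C nc pow_eq_id dvd_trans by blast
  next
    fix g assume g: "g \<in> ?C - ?D"
    then have gG: "g \<in> carrier G" using CG by blast
    have "ord g dvd 7 * c"
      using C.pow_order_eq_1[of g] g c pow_eq_id[OF gG] by (simp add: order_def nat_pow_consistent[symmetric])
    moreover have "\<not> ord g dvd c" using g pow_eq_id[OF gG] by blast
    ultimately have "7 dvd ord g"
      using prime_imp_coprime[OF p7, of "ord g"] coprime_dvd_mult_right_iff[of "ord g" 7 c]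
      by (auto simp: coprime_commute)
    then show "g \<in> {g \<in> carrier G. 7 dvd ord g}" using gG by simp
  qed
  then have "card ?C - card ?D = 48"
    using c7 finC card_Diff_subset[of ?D ?C] by simp
  ultimately have c56: "card ?C = 56" by simp
  then have n168: "order G = 168" using dvdG n by auto
  have normal: "?C \<lhd> G"
  proof (rule normal_invI[OF C])
    fix g h assume g: "g \<in> carrier G" and h: "h \<in> ?C"
    \<comment> \<open>The conjugate of x is again in P, hence commutes with h; conjugating back, g h
      g^-1 commutes with x.\<close>
    have "ord (inv g \<otimes> x \<otimes> g) = 7"
      using ord_conj[of "inv g" x] ordx[OF x] g xG by simp
    then have "inv g \<otimes> x \<otimes> g \<in> P" using uniq g xG by simp
    then have "h \<otimes> (inv g \<otimes> x \<otimes> g) = (inv g \<otimes> x \<otimes> g) \<otimes> h"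
      using comm[OF CG[OF h] x] h by (simp add: centralizer_def)
    then have "g \<otimes> (h \<otimes> (inv g \<otimes> x \<otimes> g)) \<otimes> inv g = g \<otimes> ((inv g \<otimes> x \<otimes> g) \<otimes> h) \<otimes> inv g" by simp
    then show "g \<otimes> h \<otimes> inv g \<in> ?C"
      using g xG CG[OF h] by (simp add: centralizer_def m_assoc)
  qed
  have index: "card (rcosets ?C) = 3" using lagrange[OF C] c56 n168 by simp
  have "carrier G - ?C \<subseteq> {g \<in> carrier G. 3 dvd ord g}"
  proof
    fix g assume g: "g \<in> carrier G - ?C"
    show "g \<in> {g \<in> carrier G. 3 dvd ord g}"
    proof (rule ccontr)
      assume "g \<notin> {g \<in> carrier G. 3 dvd ord g}"
      then have "\<not> 3 dvd ord g" using g by simp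
      then have "coprime (ord g) 3"
        using prime_imp_coprime[of 3 "ord g"] by (simp add: prime_nat_numeral_eq coprime_commute)
      then show False using mem_normal_if_coprime_index[OF normal, of g] g index by simp
    qed
  qed
  then have "card (carrier G - ?C) \<le> card {g \<in> carrier G. 3 dvd ord g}"
    using fin by (intro card_mono) auto
  moreover have "card (carrier G - ?C) = 112"
    using card_Diff_subset[OF finC subgroup.subset[OF C]] c56 n168 by (simp add: order_def)
  ultimately show ?thesis by simp
qed

text \<open>The 6 N elements of order 7 are among 48, N is 1 modulo 7, and N = 1 would give at least
  112 instead of 56 elements of order divisible by 3; so N = 8. Then 6 * 8 = 48 leaves no room for
  elements of order 14, 21 or any larger multiple of 7.\<close>

theorem Exp_rho_imp_subgroups_order_7:
  assumes fin: "finite (carrier G)" and E: "Exp_rho G = {48, 56, 105}"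
  shows "order G \<in> {42, 84, 168}"
    and "card {H. subgroup H G \<and> card H = 7} = 8"
    and "\<And>g. g \<in> carrier G \<Longrightarrow> 7 dvd ord g \<Longrightarrow> ord g = 7"
    and "card {g \<in> carrier G. 3 dvd ord g} = 56"
proof -
  note n = Exp_rho_imp_order[OF assms]
  have p3: "prime (3::nat)" and p7: "prime (7::nat)" by (simp_all add: prime_nat_numeral_eq)
  have sq: "\<not> 7 ^ 2 dvd order G" "\<not> 3 ^ 2 dvd order G" "7 dvd order G"
    using n(1) by (elim insertE emptyE; simp)+
  have c7: "card {g \<in> carrier G. 7 dvd ord g} = 48" and c3: "card {g \<in> carrier G. 3 dvd ord g} = 56"
    using rho_exponent_eq_card[OF fin p7 sq(1)] rho_exponent_eq_card[OF fin p3 sq(2)] n by auto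
  let ?N = "card {H. subgroup H G \<and> card H = 7}"
  have sub: "{g \<in> carrier G. ord g = 7} \<subseteq> {g \<in> carrier G. 7 dvd ord g}" by auto
  have c: "card {g \<in> carrier G. ord g = 7} = 6 * ?N"
    using card_elements_prime_order[OF fin p7] by simp
  have "card {g \<in> carrier G. ord g = 7} \<le> card {g \<in> carrier G. 7 dvd ord g}"
    using sub fin by (intro card_mono) auto
  then have "?N \<le> 8" using c c7 by simp
  moreover have "7 dvd 1 + 6 * ?N"
    using card_prime_subgroups_mod[OF fin p7 sq(3,1)] by simp
  moreover have "?N \<noteq> 1"
    using unique_subgroup_order_7[OF fin n(1) c7] c3 by auto
  ultimately show N: "?N = 8" by presburger
  then have "{g \<in> carrier G. ord g = 7} = {g \<in> carrier G. 7 dvd ord g}"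
    using c c7 sub fin by (intro card_subset_eq) auto
  then show "\<And>g. g \<in> carrier G \<Longrightarrow> 7 dvd ord g \<Longrightarrow> ord g = 7" by blast
  show "order G \<in> {42, 84, 168}" "card {g \<in> carrier G. 3 dvd ord g} = 56" using n c3 by auto
qed

end

section \<open>The action on the subgroups of order 7\<close>

definition conj_set :: "('a, 'b) monoid_scheme \<Rightarrow> 'a \<Rightarrow> 'a set \<Rightarrow> 'a set" where
  "conj_set G g H = (\<lambda>h. g \<otimes>\<^bsub>G\<^esub> h \<otimes>\<^bsub>G\<^esub> inv\<^bsub>G\<^esub> g) ` H"

context group
begin

lemma conj_set_mult:
  assumes "g \<in> carrier G" "h \<in> carrier G" "H \<subseteq> carrier G"
  shows "conj_set G (g \<otimes> h) H = conj_set G g (conj_set G h H)"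
  unfolding conj_set_def image_image
  using assms by (intro image_cong refl) (auto simp: m_assoc inv_mult_group)

lemma conj_set_one:
  assumes "H \<subseteq> carrier G"
  shows "conj_set G \<one> H = H"
proof -
  have "\<one> \<otimes> h \<otimes> inv \<one> = h" if "h \<in> H" for h using that assms by auto
  then show ?thesis by (simp add: conj_set_def)
qed

lemma conj_set_closed:
  assumes "g \<in> carrier G" "H \<subseteq> carrier G"
  shows "conj_set G g H \<subseteq> carrier G"
  using assms by (auto simp: conj_set_def)

lemma card_conj_set:
  assumes "g \<in> carrier G" "H \<subseteq> carrier G"
  shows "card (conj_set G g H) = card H"
  unfolding conj_set_def
  using assms by (intro card_image) (meson conjugation_is_inj inj_onI subsetD)

lemma subgroup_conj_set:
  assumes "g \<in> carrier G" "subgroup H G"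
  shows "subgroup (conj_set G g H) G"
proof
  note sub = subgroup.subset[OF assms(2)]
  show "conj_set G g H \<subseteq> carrier G" using conj_set_closed assms(1) sub by blast
  have "g \<otimes> \<one> \<otimes> inv g = \<one>" using assms by simp
  then show "\<one> \<in> conj_set G g H"
    unfolding conj_set_def using subgroup.one_closed[OF assms(2)] by (metis imageI)
next
  fix a b assume "a \<in> conj_set G g H" "b \<in> conj_set G g H"
  then obtain h k where h: "h \<in> H" "a = g \<otimes> h \<otimes> inv g" and k: "k \<in> H" "b = g \<otimes> k \<otimes> inv g"
    by (auto simp: conj_set_def)
  have "a \<otimes> b = g \<otimes> (h \<otimes> k) \<otimes> inv g"
    using h k assms subgroup.mem_carrier[OF assms(2)] by (simp add: m_assoc)
  then show "a \<otimes> b \<in> conj_set G g H"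
    unfolding conj_set_def using subgroup.m_closed[OF assms(2) h(1) k(1)] by blast
next
  fix a assume "a \<in> conj_set G g H"
  then obtain h where h: "h \<in> H" "a = g \<otimes> h \<otimes> inv g" by (auto simp: conj_set_def)
  have "inv a = g \<otimes> inv h \<otimes> inv g"
    using h assms subgroup.mem_carrier[OF assms(2)] by (simp add: m_assoc inv_mult_group)
  then show "inv a \<in> conj_set G g H"
    unfolding conj_set_def using subgroup.m_inv_closed[OF assms(2) h(1)] by blast
qed

lemma conj_set_mem_subgroup:
  assumes "subgroup H G" "h \<in> H" "card H = p" "finite H"
  shows "conj_set G h H = H"
proof (rule card_subset_eq)
  have hG: "h \<in> carrier G" using assms subgroup.mem_carrier by metis
  show "conj_set G h H \<subseteq> H"
    using assms(1,2) by (auto simp: conj_set_def subgroup.m_closed subgroup.m_inv_closed)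
  show "card (conj_set G h H) = card H" using card_conj_set hG subgroup.subset[OF assms(1)] by simp
qed fact

end

text \<open>\<open>BijGroup E\<close> consists of functions that are \<open>undefined\<close>
  outside \<open>E\<close>, hence the restrictions. Bijectivity comes from the action of the inverse
  element.\<close>

lemma (in group) group_action_restrict:
  assumes closed: "\<And>g x. g \<in> carrier G \<Longrightarrow> x \<in> E \<Longrightarrow> f g x \<in> E"
    and mult: "\<And>g h x. g \<in> carrier G \<Longrightarrow> h \<in> carrier G \<Longrightarrow> x \<in> E \<Longrightarrow> f (g \<otimes> h) x = f g (f h x)"
    and one: "\<And>x. x \<in> E \<Longrightarrow> f \<one> x = x"
  shows "group_action G E (\<lambda>g. restrict (f g) E)"
proof -
  have inv: "f (inv g) (f g x) = x" "f g (f (inv g) x) = x" if "g \<in> carrier G" "x \<in> E" for g x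
    using that mult[of "inv g" g x] mult[of g "inv g" x] one by auto
  have Bij: "restrict (f g) E \<in> Bij E" if g: "g \<in> carrier G" for g
  proof -
    have "bij_betw (f g) E E"
      using g closed inv by (intro bij_betwI[where g = "f (inv g)"]) auto
    then have "bij_betw (restrict (f g) E) E E" by (simp cong: bij_betw_cong)
    then show ?thesis by (simp add: Bij_def)
  qed
  have "(\<lambda>g. restrict (f g) E) \<in> hom G (BijGroup E)"
  proof (rule homI)
    fix g h assume gh: "g \<in> carrier G" "h \<in> carrier G"
    have "restrict (f (g \<otimes> h)) E = compose E (restrict (f g) E) (restrict (f h) E)"
      using gh closed mult by (auto simp: compose_def restrict_def fun_eq_iff)
    then show "restrict (f (g \<otimes> h)) E = restrict (f g) E \<otimes>\<^bsub>BijGroup E\<^esub> restrict (f h) E"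
      using gh Bij by (simp add: BijGroup_def)
  qed (use Bij in \<open>simp add: BijGroup_def\<close>)
  then show ?thesis
    by (simp add: group_action_def group_hom_def group_hom_axioms_def group_BijGroup group_axioms)
qed

text \<open>What remains of the exponents once they have been evaluated. The orders 42 and 84 are
  still open here and drop out in \<open>card_fixer_1\<close>.\<close>

locale eight_subgroups = group +
  assumes fin: "finite (carrier G)"
    and order_cases: "order G \<in> {42, 84, 168}"
    and card_points: "card {H. subgroup H G \<and> card H = 7} = 8"
    and ord_7: "\<And>g. g \<in> carrier G \<Longrightarrow> 7 dvd ord g \<Longrightarrow> ord g = 7"
    and card_ord_3: "card {g \<in> carrier G. 3 dvd ord g} = 56"
begin

definition points :: "'a set set" where
  "points = {H. subgroup H G \<and> card H = 7}"

text \<open>Pointwise stabilizer: for one point it is the normalizer of that subgroup; for two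
  points it will become the group of dilations fixing 0 and infinity.\<close>

definition fixer :: "'a set set \<Rightarrow> 'a set" where
  "fixer U = {g \<in> carrier G. \<forall>A\<in>U. conj_set G g A = A}"

lemma prime_7: "prime (7::nat)" by (simp add: prime_nat_numeral_eq)

lemma finite_points: "finite points"
  using card_points unfolding points_def by (metis card.infinite zero_neq_numeral)

lemma point_subset: "A \<in> points \<Longrightarrow> A \<subseteq> carrier G"
  by (auto simp: points_def dest: subgroup.subset)

lemma point_mem: "A \<in> points \<Longrightarrow> a \<in> A \<Longrightarrow> a \<in> carrier G"
  using point_subset by blast

lemma act_closed: "g \<in> carrier G \<Longrightarrow> A \<in> points \<Longrightarrow> conj_set G g A \<in> points"
  by (simp add: points_def subgroup_conj_set card_conj_set subgroup.subset)

lemma act_mult: "g \<in> carrier G \<Longrightarrow> h \<in> carrier G \<Longrightarrow> A \<in> points \<Longrightarrow>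
    conj_set G (g \<otimes> h) A = conj_set G g (conj_set G h A)"
  using conj_set_mult point_subset by blast

lemma act_one: "A \<in> points \<Longrightarrow> conj_set G \<one> A = A"
  using conj_set_one point_subset by blast

lemma act_inv:
  assumes "g \<in> carrier G" "A \<in> points"
  shows "conj_set G (inv g) (conj_set G g A) = A" "conj_set G g (conj_set G (inv g) A) = A"
  using assms act_mult[of "inv g" g A] act_mult[of g "inv g" A] act_one by auto

lemma act_inj:
  assumes "g \<in> carrier G" "A \<in> points" "B \<in> points" "conj_set G g A = conj_set G g B"
  shows "A = B"
  using assms act_inv(1) by metis

lemma act_self: "A \<in> points \<Longrightarrow> a \<in> A \<Longrightarrow> conj_set G a A = A"
  using conj_set_mem_subgroup[of A a 7] fin finite_subset point_subset by (auto simp: points_def)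

lemma action: "group_action G points (\<lambda>g. restrict (conj_set G g) points)"
  using act_closed act_mult act_one by (intro group_action_restrict) auto

lemma fixer_subgroup:
  assumes "U \<subseteq> points"
  shows "subgroup (fixer U) G"
proof
  show "fixer U \<subseteq> carrier G" by (auto simp: fixer_def)
  show "\<one> \<in> fixer U" using assms act_one by (auto simp: fixer_def)
  fix g h assume "g \<in> fixer U" "h \<in> fixer U"
  then show "g \<otimes> h \<in> fixer U" using assms act_mult[of g h] by (auto simp: fixer_def)
next
  fix g assume g: "g \<in> fixer U"
  then have "conj_set G (inv g) A = A" if "A \<in> U" for A
    using that assms act_inv(1)[of g A] by (auto simp: fixer_def)
  then show "inv g \<in> fixer U" using g by (auto simp: fixer_def)
qed

lemma ord_point: "A \<in> points \<Longrightarrow> a \<in> A \<Longrightarrow> a \<noteq> \<one> \<Longrightarrow> ord a = 7"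
  using prime_subgroup_eq_generate(2)[OF fin _ _ prime_7] unfolding points_def by blast

lemma point_generated:
  assumes "A \<in> points" "a \<in> A" "a \<noteq> \<one>" "b \<in> A"
  obtains k :: nat where "k < 7" "b = a [^] k"
proof -
  have aG: "a \<in> carrier G" using assms point_mem by blast
  have "A = generate G {a}"
    using prime_subgroup_eq_generate(1)[OF fin _ _ prime_7] assms by (simp add: points_def)
  then obtain k :: nat where k: "b = a [^] k"
    using generate_pow_on_finite_carrier[OF fin aG] assms(4) by auto
  have "a [^] (7::nat) = \<one>" using aG ord_point[OF assms(1-3)] pow_ord_eq_1[OF aG] by simp
  then have "a [^] (k mod 7) = a [^] k" using pow_cong[OF aG, of 7 "k mod 7" k] by simp
  then show ?thesis using that[of "k mod 7"] k by simp
qed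

lemma points_inter:
  assumes "A \<in> points" "B \<in> points" "u \<in> A" "u \<in> B" "u \<noteq> \<one>"
  shows "A = B"
  using prime_subgroup_eq_generate(1)[OF fin _ _ prime_7] assms unfolding points_def
  by (metis (mono_tags, lifting) mem_Collect_eq)

text \<open>B is normal in its normalizer with index prime to 7, because 49 does not divide |G|. An
  element of order 7 normalizing B thus lies in B, and subgroups of order 7 sharing it
  coincide.\<close>

lemma fixed_point_own:
  assumes A: "A \<in> points" and B: "B \<in> points" and a: "a \<in> A" "a \<noteq> \<one>" and fx: "conj_set G a B = B"
  shows "A = B"
proof -
  let ?N = "fixer {B}"
  have N: "subgroup ?N G" using fixer_subgroup B by simp
  interpret N: group "G\<lparr>carrier := ?N\<rparr>" using subgroup_imp_group[OF N] .
  have aG: "a \<in> carrier G" using A a point_mem by blast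
  have BG: "subgroup B G" "card B = 7" using B by (auto simp: points_def)
  have BN: "B \<subseteq> ?N" using act_self[OF B] point_mem[OF B] by (auto simp: fixer_def)
  have sB: "subgroup B (G\<lparr>carrier := ?N\<rparr>)" using subgroup_incl[OF BG(1) N BN] .
  have nB: "B \<lhd> G\<lparr>carrier := ?N\<rparr>"
  proof (rule N.normal_invI[OF sB])
    fix x h assume x: "x \<in> carrier (G\<lparr>carrier := ?N\<rparr>)" and h: "h \<in> B"
    have "x \<otimes> h \<otimes> inv x \<in> conj_set G x B" using h by (simp add: conj_set_def)
    then show "x \<otimes>\<^bsub>G\<lparr>carrier := ?N\<rparr>\<^esub> h \<otimes>\<^bsub>G\<lparr>carrier := ?N\<rparr>\<^esub> inv\<^bsub>G\<lparr>carrier := ?N\<rparr>\<^esub> x \<in> B"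
      using x m_inv_consistent[OF N] by (simp add: fixer_def)
  qed
  have aN: "a \<in> carrier (G\<lparr>carrier := ?N\<rparr>)" using aG fx by (simp add: fixer_def)
  have lag: "card (rcosets\<^bsub>G\<lparr>carrier := ?N\<rparr>\<^esub> B) * 7 = card ?N"
    using N.lagrange[OF sB] BG(2) by (simp add: order_def)
  have "card ?N dvd order G" unfolding lagrange[OF N, symmetric] by simp
  then have "card (rcosets\<^bsub>G\<lparr>carrier := ?N\<rparr>\<^esub> B) * 7 dvd order G" using lag by simp
  moreover have "\<not> 7 * 7 dvd order G" using order_cases by auto
  ultimately have "\<not> 7 dvd card (rcosets\<^bsub>G\<lparr>carrier := ?N\<rparr>\<^esub> B)"
    using mult_dvd_mono[OF _ dvd_refl[of 7]] dvd_trans by blast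
  then have co: "coprime 7 (card (rcosets\<^bsub>G\<lparr>carrier := ?N\<rparr>\<^esub> B))"
    using prime_imp_coprime[OF prime_7] by blast
  have "N.ord a = 7"
    using N.ord_unique[OF aN, of 7] pow_eq_id[OF aG] ord_point[OF A a]
    by (simp add: nat_pow_consistent[symmetric])
  then have "a \<in> B" using N.mem_normal_if_coprime_index[OF nB aN] co by simp
  then show ?thesis using points_inter A B a by blast
qed

text \<open>By \<open>fixed_point_own\<close> only the identity of A fixes B, so the seven elements
  of A carry B to seven different points, which exhaust the points other than A. This regular action
  is the source of 2-transitivity.\<close>

lemma bij_betw_point_action:
  assumes A: "A \<in> points" and B: "B \<in> points" and AB: "A \<noteq> B"
  shows "bij_betw (\<lambda>a. conj_set G a B) A (points - {A})"
proof -
  have inj: "inj_on (\<lambda>a. conj_set G a B) A"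
  proof (rule inj_onI)
    fix a b assume ab: "a \<in> A" "b \<in> A" "conj_set G a B = conj_set G b B"
    have G: "a \<in> carrier G" "b \<in> carrier G" using ab point_mem[OF A] by auto
    have "conj_set G (inv b \<otimes> a) B = B"
      using act_mult[of "inv b" a B] ab(3) act_inv(1)[OF G(2) B] G B by simp
    moreover have "inv b \<otimes> a \<in> A"
      using A ab by (simp add: points_def subgroup.m_closed subgroup.m_inv_closed)
    ultimately have "inv b \<otimes> a = \<one>" using fixed_point_own[OF A B] AB by blast
    then show "a = b" using G by (metis inv_closed inv_comm inv_inv inv_equality)
  qed
  moreover have "(\<lambda>a. conj_set G a B) ` A = points - {A}"
  proof (rule card_subset_eq)
    show "(\<lambda>a. conj_set G a B) ` A \<subseteq> points - {A}"
    proof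
      fix D assume "D \<in> (\<lambda>a. conj_set G a B) ` A"
      then obtain a where a: "a \<in> A" "D = conj_set G a B" by auto
      then have "D \<noteq> A" using act_self[OF A a(1)] act_inj[OF point_mem[OF A a(1)] A B] AB by metis
      then show "D \<in> points - {A}" using a act_closed[OF point_mem[OF A a(1)] B] by simp
    qed
    show "card ((\<lambda>a. conj_set G a B) ` A) = card (points - {A})"
      using card_image[OF inj] A card_points finite_points by (simp add: points_def card_Diff_singleton)
  qed (use finite_points in simp)
  ultimately show ?thesis by (simp add: bij_betw_def)
qed

lemma obtain_point_action:
  assumes "A \<in> points" "B \<in> points" "D \<in> points" "A \<noteq> B" "A \<noteq> D"
  obtains a where "a \<in> A" "conj_set G a B = D"
proof -
  have "D \<in> (\<lambda>a. conj_set G a B) ` A"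
    using bij_betw_imp_surj_on[OF bij_betw_point_action[OF assms(1,2,4)]] assms(3,5) by simp
  then show ?thesis using that by auto
qed

lemma point_action_inj:
  assumes "A \<in> points" "B \<in> points" "A \<noteq> B" "a \<in> A" "b \<in> A" "conj_set G a B = conj_set G b B"
  shows "a = b"
  using inj_onD[OF bij_betw_imp_inj_on[OF bij_betw_point_action[OF assms(1-3)]] assms(6,4,5)] .

text \<open>An element of a third point D already carries A to B.\<close>

lemma transitive:
  assumes "A \<in> points" "B \<in> points"
  obtains g where "g \<in> carrier G" "conj_set G g A = B"
proof -
  have "\<not> points \<subseteq> {A, B}"
  proof
    assume "points \<subseteq> {A, B}"
    then have "card points \<le> card {A, B}" by (intro card_mono) auto
    also have "card {A, B} \<le> 2" by (simp add: card_insert_if)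
    finally show False using card_points by (simp add: points_def)
  qed
  then obtain D where D: "D \<in> points" "D \<noteq> A" "D \<noteq> B" by blast
  obtain a where "a \<in> D" "conj_set G a A = B"
    using obtain_point_action[OF D(1) assms D(2,3)] .
  then show ?thesis using that point_mem[OF D(1)] by blast
qed

lemma card_fixer_1:
  assumes A: "A \<in> points"
  shows "card (fixer {A}) = 21"
proof -
  have "8 * card (fixer {A}) = order G"
  proof -
    let ?f = "\<lambda>g. restrict (conj_set G g) points"
    have "orbit G ?f A = points"
    proof
      show "orbit G ?f A \<subseteq> points" using A act_closed by (auto simp: orbit_def)
      show "points \<subseteq> orbit G ?f A"
      proof
        fix B assume "B \<in> points"
        then obtain g where "g \<in> carrier G" "conj_set G g A = B" using transitive A by blast
        then show "B \<in> orbit G ?f A" using A by (auto simp: orbit_def)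
      qed
    qed
    moreover have "stabilizer G ?f A = fixer {A}" using A by (auto simp: stabilizer_def fixer_def)
    ultimately show ?thesis
      using group_action.orbit_stabilizer_theorem[OF action A] card_points by (simp add: points_def)
  qed
  \<comment> \<open>Among 42, 84 and 168 only 168 is a multiple of 8.\<close>
  then show ?thesis using order_cases by (elim insertE emptyE; presburger)
qed

text \<open>A acts regularly on the other points, so every element fixing A is uniquely the product
  of an element of A and one that also fixes B; 21 = 7 * 3.\<close>

lemma card_fixer_2:
  assumes A: "A \<in> points" and B: "B \<in> points" and AB: "A \<noteq> B"
  shows "card (fixer {A, B}) = 3"
proof -
  have "bij_betw (\<lambda>(a, s). a \<otimes> s) (A \<times> fixer {A, B}) (fixer {A})"
  proof (rule bij_betw_imageI)
    show "inj_on (\<lambda>(a, s). a \<otimes> s) (A \<times> fixer {A, B})"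
    proof (rule inj_onI, clarify)
      fix a s b r assume h: "a \<in> A" "b \<in> A" "s \<in> fixer {A, B}" "r \<in> fixer {A, B}" "a \<otimes> s = b \<otimes> r"
      have G: "a \<in> carrier G" "b \<in> carrier G" "s \<in> carrier G" "r \<in> carrier G"
        using h point_mem[OF A] by (auto simp: fixer_def)
      have "conj_set G a B = conj_set G b B"
        using act_mult[OF G(1,3) B] act_mult[OF G(2,4) B] h by (simp add: fixer_def)
      then have "a = b" using point_action_inj[OF A B AB] h by blast
      then show "a = b \<and> s = r" using h(5) G by simp
    qed
    show "(\<lambda>(a, s). a \<otimes> s) ` (A \<times> fixer {A, B}) = fixer {A}"
    proof
      show "(\<lambda>(a, s). a \<otimes> s) ` (A \<times> fixer {A, B}) \<subseteq> fixer {A}"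
        using act_mult[OF _ _ A] act_self[OF A] point_mem[OF A] by (auto simp: fixer_def)
      show "fixer {A} \<subseteq> (\<lambda>(a, s). a \<otimes> s) ` (A \<times> fixer {A, B})"
      proof
        fix g assume "g \<in> fixer {A}"
        then have g: "g \<in> carrier G" "conj_set G g A = A" by (auto simp: fixer_def)
        have "conj_set G g B \<noteq> A" using act_inj[OF g(1) A B] g(2) AB by metis
        then obtain a where a: "a \<in> A" "conj_set G a B = conj_set G g B"
          using obtain_point_action[OF A B act_closed[OF g(1) B] AB] by metis
        have aG: "a \<in> carrier G" using a A point_mem by blast
        have "conj_set G (inv a \<otimes> g) B = B"
          using act_mult[of "inv a" g B] act_inv(1)[OF aG B] a aG g B by simp
        moreover have "conj_set G (inv a \<otimes> g) A = A"
          using act_mult[of "inv a" g A] act_inv(1)[OF aG A] act_self[OF A a(1)] aG g A by simp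
        ultimately have "inv a \<otimes> g \<in> fixer {A, B}" using aG g by (simp add: fixer_def)
        moreover have "g = a \<otimes> (inv a \<otimes> g)" using aG g by simp
        ultimately show "g \<in> (\<lambda>(a, s). a \<otimes> s) ` (A \<times> fixer {A, B})" using a(1) by force
      qed
    qed
  qed
  then have "card (A \<times> fixer {A, B}) = 21" using card_fixer_1[OF A] bij_betw_same_card by metis
  then show ?thesis using A by (simp add: card_cartesian_product points_def)
qed

lemma fixer_2_pow_3:
  assumes "A \<in> points" "B \<in> points" "A \<noteq> B" "s \<in> fixer {A, B}"
  shows "s [^] (3::nat) = \<one>"
proof -
  have "subgroup (fixer {A, B}) G" using assms fixer_subgroup by simp
  then interpret S: group "G\<lparr>carrier := fixer {A, B}\<rparr>" using subgroup_imp_group by blast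
  show ?thesis using S.pow_order_eq_1[of s] assms card_fixer_2[OF assms(1-3)]
    by (simp add: order_def nat_pow_consistent[symmetric])
qed

text \<open>If they commuted, s a would have order divisible by 7, hence equal to 7 by
  \<open>ord_7\<close>; but its seventh power is s.\<close>

lemma not_commute_3_7:
  assumes G: "s \<in> carrier G" "a \<in> carrier G" and s: "s [^] (3::nat) = \<one>" "s \<noteq> \<one>" and a: "ord a = 7"
  shows "s \<otimes> a \<noteq> a \<otimes> s"
proof
  assume comm: "s \<otimes> a = a \<otimes> s"
  have a7: "a [^] (7::nat) = \<one>" using pow_ord_eq_1[OF G(2)] a by simp
  have s7: "s [^] (7::nat) = s"
    using pow_cong[OF G(1) s(1), of 7 1] G by (simp add: cong_def)
  have s21: "s [^] (21::nat) = \<one>" using pow_cong[OF G(1) s(1), of 21 0] by (simp add: cong_def)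
  have a21: "a [^] (21::nat) = \<one>" using pow_cong[OF G(2) a7, of 21 0] by (simp add: cong_def)
  have p: "(s \<otimes> a) [^] (n::nat) = s [^] n \<otimes> a [^] n" for n using pow_mult_distrib[OF comm G] .
  have sa: "s \<otimes> a \<in> carrier G" using G by simp
  have "ord (s \<otimes> a) dvd 7 * 3" using p[of 21] s21 a21 pow_eq_id[OF sa] by simp
  moreover have "\<not> ord (s \<otimes> a) dvd 3"
  proof
    assume "ord (s \<otimes> a) dvd 3"
    then have "a [^] (3::nat) = \<one>" using p[of 3] s(1) pow_eq_id[OF sa, of 3] G by simp
    then have "7 dvd (3::nat)" using pow_eq_id[OF G(2)] a by metis
    then show False by simp
  qed
  ultimately have "7 dvd ord (s \<otimes> a)"
    using prime_imp_coprime[OF prime_7, of "ord (s \<otimes> a)"] coprime_dvd_mult_right_iff[of "ord (s \<otimes> a)" 7 3]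
    by (auto simp: coprime_commute)
  then have "ord (s \<otimes> a) = 7" using ord_7 sa by blast
  then have "(s \<otimes> a) [^] (7::nat) = \<one>" using pow_ord_eq_1[OF sa] by simp
  then show False using p[of 7] a7 s7 s G by simp
qed

text \<open>Take a in A carrying B to D. The conjugate of a by s lies in A and also carries B to D,
  so it equals a by regularity. A nontrivial s, being of order 3, cannot commute with an element of
  order 7.\<close>

lemma fixer_3:
  assumes "A \<in> points" "B \<in> points" "D \<in> points" "A \<noteq> B" "A \<noteq> D" "B \<noteq> D"
    and s: "s \<in> carrier G" "conj_set G s A = A" "conj_set G s B = B" "conj_set G s D = D"
  shows "s = \<one>"
proof (rule ccontr)
  assume ne: "s \<noteq> \<one>"
  obtain a where a: "a \<in> A" "conj_set G a B = D"
    using obtain_point_action[OF assms(1-5)] by blast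
  have aG: "a \<in> carrier G" using a assms(1) point_mem by blast
  have a1: "a \<noteq> \<one>" using a(2) act_one[OF assms(2)] assms(6) by auto
  have "s \<otimes> a \<otimes> inv s \<in> conj_set G s A" using a by (simp add: conj_set_def)
  then have sa: "s \<otimes> a \<otimes> inv s \<in> A" using s by simp
  have si: "conj_set G (inv s) B = B" using act_inv(1)[OF s(1) assms(2)] s(3) by simp
  have "conj_set G (s \<otimes> a \<otimes> inv s) B = conj_set G a B"
    using s aG assms(2) si a act_closed by (simp add: act_mult)
  then have "s \<otimes> a \<otimes> inv s = a"
    using point_action_inj[OF assms(1,2,4) sa a(1)] by blast
  then have "s \<otimes> a = a \<otimes> s" using s(1) aG by (metis inv_solve_right' m_closed)
  moreover have "s [^] (3::nat) = \<one>"
    using fixer_2_pow_3[OF assms(1,2,4)] s by (simp add: fixer_def)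
  ultimately show False using not_commute_3_7[OF s(1) aG _ ne] ord_point[OF assms(1) a(1) a1] by blast
qed

text \<open>The 28 two-point stabilizers have two nontrivial elements each and, by
  \<open>fixer_3\<close>, meet trivially. These 2 * 28 = 56 elements are therefore all the elements
  of order divisible by 3, so none has order 6.\<close>

lemma ord_3:
  assumes "g \<in> carrier G" "3 dvd ord g"
  shows "g [^] (3::nat) = \<one>"
proof -
  let ?I = "{U. U \<subseteq> points \<and> card U = 2}"
  let ?F = "\<Union>U\<in>?I. fixer U - {\<one>}"
  have finI: "finite ?I" using finite_points by simp
  have cI: "card ?I = 28"
    using n_subsets[OF finite_points, of 2] card_points by (simp add: points_def choose_two)
  have two: "\<exists>A B. U = {A, B} \<and> A \<in> points \<and> B \<in> points \<and> A \<noteq> B" if "U \<in> ?I" for U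
    using that by (auto simp: card_2_iff)
  have fU: "card (fixer U) = 3" "\<forall>s\<in>fixer U. s [^] (3::nat) = \<one>" "\<one> \<in> fixer U" if U: "U \<in> ?I" for U
  proof -
    obtain A B where AB: "U = {A, B}" "A \<in> points" "B \<in> points" "A \<noteq> B" using two[OF U] by blast
    show "card (fixer U) = 3" "\<forall>s\<in>fixer U. s [^] (3::nat) = \<one>"
      using card_fixer_2[OF AB(2-4)] fixer_2_pow_3[OF AB(2-4)] AB(1) by simp_all
    show "\<one> \<in> fixer U" using subgroup.one_closed[OF fixer_subgroup[of U]] U by blast
  qed
  have disj: "(fixer U - {\<one>}) \<inter> (fixer V - {\<one>}) = {}" if UV: "U \<in> ?I" "V \<in> ?I" "U \<noteq> V" for U V
  proof (rule ccontr)
    assume "(fixer U - {\<one>}) \<inter> (fixer V - {\<one>}) \<noteq> {}"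
    then obtain s where s: "s \<in> fixer U" "s \<in> fixer V" "s \<noteq> \<one>" by blast
    obtain A B where AB: "U = {A, B}" "A \<in> points" "B \<in> points" "A \<noteq> B" using two[OF UV(1)] by blast
    have "\<not> V \<subseteq> U" using that card_subset_eq[of U V] AB(1) by fastforce
    then obtain D where D: "D \<in> V" "D \<notin> U" by blast
    then have "D \<in> points" using that(2) by blast
    then have "s = \<one>" using fixer_3[of A B D s] AB D s by (auto simp: fixer_def)
    then show False using s by simp
  qed
  have "card ?F = (\<Sum>U\<in>?I. card (fixer U - {\<one>}))"
  proof (rule card_UN_disjoint[OF finI])
    show "\<forall>U\<in>?I. finite (fixer U - {\<one>})"
      using finite_subset[OF _ fin] by (auto simp: fixer_def)
    show "\<forall>U\<in>?I. \<forall>V\<in>?I. U \<noteq> V \<longrightarrow> (fixer U - {\<one>}) \<inter> (fixer V - {\<one>}) = {}"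
      using disj by blast
  qed
  also have "\<dots> = (\<Sum>U\<in>?I. 2)"
    using fU by (intro sum.cong refl) (simp add: card_Diff_singleton)
  finally have "card ?F = 56" using cI by simp
  moreover have sub: "?F \<subseteq> {g \<in> carrier G. 3 dvd ord g}"
  proof
    fix s assume "s \<in> ?F"
    then obtain U where U: "U \<in> ?I" "s \<in> fixer U" "s \<noteq> \<one>" by blast
    then have sG: "s \<in> carrier G" by (simp add: fixer_def)
    have "ord s dvd 3" using fU(2)[OF U(1)] U(2) pow_eq_id[OF sG] by blast
    moreover have "ord s \<noteq> 1" using ord_eq_1[OF sG] U(3) by blast
    moreover have "prime (3::nat)" by (simp add: prime_nat_numeral_eq)
    ultimately have "ord s = 3" using prime_nat_iff by blast
    then show "s \<in> {g \<in> carrier G. 3 dvd ord g}" using sG by simp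
  qed
  ultimately have "?F = {g \<in> carrier G. 3 dvd ord g}"
    using card_ord_3 fin by (intro card_subset_eq) auto
  then have "g \<in> ?F" using assms by blast
  then show ?thesis using fU(2) by blast
qed

text \<open>Point stabilizers have the odd order 21.\<close>

lemma involution_fixes_none:
  assumes "u \<in> carrier G" "u \<otimes> u = \<one>" "A \<in> points" "conj_set G u A = A"
  shows "u = \<one>"
proof -
  have "subgroup (fixer {A}) G" using assms fixer_subgroup by simp
  then interpret S: group "G\<lparr>carrier := fixer {A}\<rparr>" using subgroup_imp_group by blast
  have "u [^] (21::nat) = \<one>"
    using S.pow_order_eq_1[of u] assms card_fixer_1[OF assms(3)]
    by (simp add: order_def fixer_def nat_pow_consistent[symmetric])
  moreover have "u [^] (2::nat) = \<one>" using assms by (simp add: numeral_2_eq_2)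
  then have "u [^] (21::nat) = u [^] (1::nat)"
    using pow_cong[OF assms(1), of 2 21 1] by (simp add: cong_def)
  ultimately show ?thesis using assms(1) by simp
qed

end

section \<open>The projective line over seven elements\<close>

lemma (in group) pow_eq_iff_cong:
  fixes i j :: nat
  assumes "g \<in> carrier G"
  shows "g [^] i = g [^] j \<longleftrightarrow> [i = j] (mod ord g)"
proof -
  have "g [^] i = g [^] j \<longleftrightarrow> int (ord g) dvd int j - int i"
    using int_pow_eq[OF assms, of "int i" "int j"] by (simp add: int_pow_int)
  also have "\<dots> \<longleftrightarrow> [int j = int i] (mod int (ord g))" by (simp add: cong_iff_dvd_diff)
  also have "\<dots> \<longleftrightarrow> [i = j] (mod ord g)" by (simp add: cong_int_iff cong_sym_eq)
  finally show ?thesis .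
qed

text \<open>The points \<open>0, \<dots>, 6\<close> and \<open>7 = \<infinity>\<close> form the projective line over the field with 7 elements; the
  three permutations are \<open>z + 1\<close>, \<open>2 z\<close> and \<open>-1 / z\<close>.\<close>

definition moebius_translation :: "nat \<Rightarrow> nat" where
  "moebius_translation = restrict (\<lambda>i. if i < 7 then (i + 1) mod 7 else 7) {..<8}"

definition moebius_dilation :: "nat \<Rightarrow> nat" where
  "moebius_dilation = restrict (\<lambda>i. if i < 7 then 2 * i mod 7 else 7) {..<8}"

definition moebius_inversion :: "nat \<Rightarrow> nat" where
  "moebius_inversion = restrict (\<lambda>i. [7, 6, 3, 2, 5, 4, 1, 0] ! i) {..<8}"

text \<open>Common model for comparison: G and the matrix group are each identified with it, so no
  map between the two has to be written down.\<close>

definition moebius_group :: "(nat \<Rightarrow> nat) monoid" where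
  "moebius_group = (BijGroup {..<8})\<lparr>carrier :=
     generate (BijGroup {..<8}) {moebius_translation, moebius_dilation, moebius_inversion}\<rparr>"

text \<open>P is infinity and Q is 0; x acts as z + 1, y as 2 z and t as c / z with a constant c
  still to be adjusted. \<open>yx\<close> and \<open>ty\<close> are the corresponding relations, the
  latter saying that t inverts y.\<close>

locale moebius_frame = eight_subgroups +
  fixes P Q :: "'a set" and x y t :: 'a
  assumes PQ: "P \<in> points" "Q \<in> points" "P \<noteq> Q"
    and x: "x \<in> P" "x \<noteq> \<one>"
    and y: "y \<in> fixer {P, Q}" "y \<noteq> \<one>" and yx: "y \<otimes> x \<otimes> inv y = x [^] (2::nat)"
    and tG: "t \<in> carrier G" and tt: "t \<otimes> t = \<one>"
    and tP: "conj_set G t P = Q" and tQ: "conj_set G t Q = P"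
    and ty: "t \<otimes> y = y \<otimes> y \<otimes> t"
begin

text \<open>The field element k, reached from 0 by k translations; the index matters only modulo
  7.\<close>

definition pt :: "nat \<Rightarrow> 'a set" where "pt k = conj_set G (x [^] k) Q"

lemma xG: "x \<in> carrier G" using x PQ point_mem by blast
lemma yG: "y \<in> carrier G" using y by (simp add: fixer_def)
lemma ord_x: "ord x = 7" using ord_point PQ x by blast
lemma yP: "conj_set G y P = P" and yQ: "conj_set G y Q = Q" using y by (auto simp: fixer_def)

lemma y3: "y \<otimes> (y \<otimes> y) = \<one>"
  using fixer_2_pow_3[OF PQ y(1)] yG by (simp add: numeral_3_eq_3 m_assoc)

lemma x_pow_mem: "x [^] (k::nat) \<in> P"
  using PQ x by (induction k) (auto simp: points_def subgroup.one_closed subgroup.m_closed)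

lemma pt_points: "pt k \<in> points"
  using act_closed PQ xG by (simp add: pt_def)

lemma pt_eq_iff: "pt i = pt j \<longleftrightarrow> [i = j] (mod 7)"
proof -
  have "pt i = pt j \<longleftrightarrow> x [^] i = x [^] j"
    unfolding pt_def using point_action_inj[OF PQ x_pow_mem x_pow_mem] by metis
  then show ?thesis using pow_eq_iff_cong[OF xG] ord_x by simp
qed

lemma pt_ne: "pt k \<noteq> P"
  using act_self[OF PQ(1) x_pow_mem] act_inj[OF _ PQ(1,2)] PQ(3) xG by (metis nat_pow_closed pt_def)

lemma pt_0: "pt 0 = Q"
  using act_one PQ by (simp add: pt_def)

lemma obtain_pt:
  assumes "A \<in> points" "A \<noteq> P"
  obtains k where "k < 7" "A = pt k"
proof -
  obtain a where a: "a \<in> P" "conj_set G a Q = A"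
    using obtain_point_action[OF PQ(1,2) assms(1) PQ(3)] assms(2) by metis
  obtain k :: nat where "k < 7" "a = x [^] k" using point_generated[OF PQ(1) x a(1)] .
  then show ?thesis using that[of k] a by (simp add: pt_def)
qed

lemma x_pt: "conj_set G x (pt k) = pt (Suc k)"
  unfolding pt_def nat_pow_Suc2[OF xG] by (rule act_mult[symmetric]) (use xG PQ in auto)

lemma y_pt: "conj_set G y (pt k) = pt (2 * k)"
proof -
  have "y \<otimes> x [^] k \<otimes> inv y = x [^] (2 * k)"
    using conj_pow[OF yG xG, of k] yx xG by (simp add: nat_pow_pow)
  then have "y \<otimes> x [^] k = x [^] (2 * k) \<otimes> y" using xG yG by (metis inv_solve_right' m_closed nat_pow_closed)
  then have "conj_set G (y \<otimes> x [^] k) Q = conj_set G (x [^] (2 * k) \<otimes> y) Q" by simp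
  then show ?thesis using xG yG PQ yQ by (simp add: act_mult pt_def)
qed

lemma t_flip: "A \<in> points \<Longrightarrow> conj_set G t A = B \<Longrightarrow> conj_set G t B = A"
  using act_mult[OF tG tG] tt act_one by auto

text \<open>Doubling the argument multiplies the value by 4, the inverse of 2 modulo 7, as it must
  for c / z.\<close>

lemma t_pt:
  assumes "conj_set G t (pt i) = pt k"
  shows "conj_set G t (pt (2 * i)) = pt (4 * k)"
proof -
  have "conj_set G (t \<otimes> y) (pt i) = conj_set G (y \<otimes> y \<otimes> t) (pt i)" using ty by simp
  then show ?thesis using assms tG yG pt_points by (simp add: act_mult act_closed y_pt)
qed

lemma fixer_cases:
  assumes "s \<in> fixer {P, Q}"
  shows "s = \<one> \<or> s = y \<or> s = y \<otimes> y"
proof -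
  have yy: "y \<otimes> y \<noteq> \<one>" using y3 y(2) yG by auto
  have "y \<otimes> y \<noteq> y" using y(2) yG by simp
  then have c: "card {\<one>, y, y \<otimes> y} = 3" using y(2) yy by auto
  have S: "subgroup (fixer {P, Q}) G" using fixer_subgroup PQ by simp
  have "{\<one>, y, y \<otimes> y} \<subseteq> fixer {P, Q}"
    using S y(1) subgroup.one_closed subgroup.m_closed by auto
  then have "{\<one>, y, y \<otimes> y} = fixer {P, Q}"
    using c card_fixer_2[OF PQ] finite_subset[OF subgroup.subset[OF S] fin] by (intro card_subset_eq) auto
  then show ?thesis using assms by blast
qed

text \<open>An element fixing P becomes, after a translation, an element fixing P and Q, hence a
  power of y. Any other element is reduced to this case by some x^k t, which carries P to the point
  k.\<close>

lemma generate_frame: "generate G {x, y, t} = carrier G"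
proof
  let ?H = "generate G {x, y, t}"
  have sub: "{x, y, t} \<subseteq> carrier G" using xG yG tG by simp
  show "?H \<subseteq> carrier G" using generate_incl[OF sub] .
  have H: "subgroup ?H G" using generate_is_subgroup[OF sub] .
  have gen: "x \<in> ?H" "y \<in> ?H" "t \<in> ?H" by (auto intro: generate.incl)
  have xk: "x [^] (k::nat) \<in> ?H" for k
    by (induction k) (auto simp: subgroup.one_closed[OF H] subgroup.m_closed[OF H] gen)
  have fixP: "u \<in> ?H" if u: "u \<in> carrier G" "conj_set G u P = P" for u
  proof -
    have "conj_set G u Q \<noteq> P" using act_inj[OF u(1) PQ(1,2)] u(2) PQ(3) by metis
    then obtain k where k: "conj_set G u Q = pt k"
      using obtain_pt[OF act_closed[OF u(1) PQ(2)]] by metis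
    let ?s = "inv (x [^] k) \<otimes> u"
    have "conj_set G ?s Q = Q"
      using act_mult[of "inv (x [^] k)" u Q] act_inv(1)[of "x [^] k" Q] k u xG PQ by (simp add: pt_def)
    moreover have "conj_set G ?s P = P"
      using act_mult[of "inv (x [^] k)" u P] act_inv(1)[of "x [^] k" P] act_self[OF PQ(1) x_pow_mem, of k]
        u xG PQ by simp
    ultimately have "?s \<in> fixer {P, Q}" using u xG by (simp add: fixer_def)
    then have "?s \<in> ?H" using fixer_cases[of ?s] gen H subgroup.one_closed subgroup.m_closed by auto
    then have "x [^] k \<otimes> ?s \<in> ?H" using subgroup.m_closed[OF H xk] by blast
    then show ?thesis using u xG by simp
  qed
  show "carrier G \<subseteq> ?H"
  proof
    fix g assume g: "g \<in> carrier G"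
    show "g \<in> ?H"
    proof (cases "conj_set G g P = P")
      case True
      then show ?thesis using fixP g by blast
    next
      case False
      then obtain k where k: "conj_set G g P = pt k"
        using obtain_pt[OF act_closed[OF g PQ(1)]] by metis
      let ?h = "x [^] k \<otimes> t"
      have h: "?h \<in> carrier G" using xG tG by simp
      have "conj_set G ?h P = pt k" using act_mult[of "x [^] k" t P] xG tG tP PQ by (simp add: pt_def)
      then have "conj_set G (inv ?h \<otimes> g) P = P"
        using act_mult[of "inv ?h" g P] act_inv(1)[OF h PQ(1)] k g h PQ by simp
      then have "inv ?h \<otimes> g \<in> ?H" using fixP[of "inv ?h \<otimes> g"] g h by simp
      moreover have "?h \<in> ?H" using subgroup.m_closed[OF H xk gen(3)] .
      ultimately have "?h \<otimes> (inv ?h \<otimes> g) \<in> ?H" using subgroup.m_closed[OF H] by blast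
      then show ?thesis using inv_mult_cancel_left(2)[OF h g] by simp
    qed
  qed
qed

text \<open>The three choices of s multiply the constant c of c / z by 1, 2 and 4 without disturbing
  the other data.\<close>

lemma frame_twist:
  assumes "s = \<one> \<or> s = y \<or> s = y \<otimes> y"
  shows "moebius_frame G P Q x y (s \<otimes> t)"
proof -
  \<comment> \<open>Rewrite rules that move every t to the right of every y and cancel t^2 and
    y^3.\<close>
  have ttc: "t \<otimes> (t \<otimes> a) = a" if "a \<in> carrier G" for a
    using that tt tG by (simp flip: m_assoc)
  have tyc: "t \<otimes> (y \<otimes> a) = y \<otimes> (y \<otimes> (t \<otimes> a))" if "a \<in> carrier G" for a
    using that ty tG yG by (simp flip: m_assoc)
  have ty': "t \<otimes> y = y \<otimes> (y \<otimes> t)" using ty tG yG by (simp add: m_assoc)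
  have y3c: "y \<otimes> (y \<otimes> (y \<otimes> a)) = a" if "a \<in> carrier G" for a
    using that y3 yG by (simp flip: m_assoc)
  have "s \<in> carrier G" using assms yG by auto
  moreover have "(s \<otimes> t) \<otimes> (s \<otimes> t) = \<one>"
    using assms yG tG by (auto simp: m_assoc ty' tyc tt ttc y3 y3c)
  moreover have "conj_set G s P = P" "conj_set G s Q = Q"
    using assms yP yQ act_one PQ act_mult[OF yG yG] by auto
  then have "conj_set G (s \<otimes> t) P = Q" "conj_set G (s \<otimes> t) Q = P"
    using \<open>s \<in> carrier G\<close> tG tP tQ PQ by (simp_all add: act_mult)
  moreover have "(s \<otimes> t) \<otimes> y = y \<otimes> y \<otimes> (s \<otimes> t)"
    using assms yG tG by (auto simp: m_assoc ty' tyc tt ttc y3 y3c)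
  ultimately show ?thesis
    using PQ x y yx tG by unfold_locales auto
qed

text \<open>If t carries 1 to c, twisting offers c, 2 c and 4 c. For c among the squares 1, 2, 4 one
  of these is 1, giving an involution with a fixed point, against
  \<open>involution_fixes_none\<close>. So c is 3, 5 or 6, and 6 = -1 is among its
  multiples.\<close>

lemma normalise_frame:
  obtains s where "moebius_frame G P Q x y s" "conj_set G s (pt 1) = pt 6"
proof -
  have "conj_set G t (pt 1) \<noteq> P"
  proof
    assume "conj_set G t (pt 1) = P"
    then have "pt 1 = Q" using t_flip[OF pt_points] tP by metis
    then show False using pt_eq_iff[of 1 0] pt_0 by (simp add: cong_def)
  qed
  then obtain c where c: "c < 7" "conj_set G t (pt 1) = pt c"
    using obtain_pt[OF act_closed[OF tG pt_points]] by metis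
  have "c \<noteq> 0"
  proof
    assume "c = 0"
    then have "conj_set G t (pt 1) = Q" using c pt_0 by simp
    then show False using t_flip[OF pt_points] tQ pt_ne by metis
  qed
  have y1: "conj_set G (y \<otimes> t) (pt 1) = pt (2 * c)"
    using act_mult[OF yG tG pt_points] c y_pt by simp
  have y2: "conj_set G (y \<otimes> y \<otimes> t) (pt 1) = pt (2 * (2 * c))"
    using act_mult[OF yG tG pt_points] act_mult[OF yG yG] act_mult[of "y \<otimes> y" t] c y_pt yG tG
      pt_points by simp
  have y0: "conj_set G (\<one> \<otimes> t) (pt 1) = pt c" using c tG by simp
  have nofix: "\<not> (conj_set G (s \<otimes> t) (pt 1) = pt 1)" if s: "s = \<one> \<or> s = y \<or> s = y \<otimes> y" for s
  proof
    assume fx: "conj_set G (s \<otimes> t) (pt 1) = pt 1"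
    interpret F: moebius_frame G P Q x y "s \<otimes> t" using frame_twist[OF s] .
    have "s \<otimes> t = \<one>" using involution_fixes_none[OF F.tG F.tt pt_points fx] .
    then show False using F.tP act_one PQ by simp
  qed
  consider "c = 1" | "c = 2" | "c = 3" | "c = 4" | "c = 5" | "c = 6" using c \<open>c \<noteq> 0\<close> by linarith
  then show ?thesis
  proof cases
    case 1
    then show ?thesis using nofix[of \<one>] y0 by simp
  next
    case 2
    then have "pt (2 * (2 * c)) = pt 1" by (simp add: pt_eq_iff cong_def)
    then show ?thesis using nofix[of "y \<otimes> y"] y2 by simp
  next
    case 3
    then show ?thesis using that[OF frame_twist[of y]] y1 by simp
  next
    case 4
    then have "pt (2 * c) = pt 1" by (simp add: pt_eq_iff cong_def)
    then show ?thesis using nofix[of y] y1 by simp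
  next
    case 5
    then have "pt (2 * (2 * c)) = pt 6" by (simp add: pt_eq_iff cong_def)
    then show ?thesis using that[OF frame_twist[of "y \<otimes> y"]] y2 by simp
  next
    case 6
    then show ?thesis using that[OF frame_twist[of \<one>]] y0 by simp
  qed
qed

section \<open>The permutation representation on eight labels\<close>

definition label :: "nat \<Rightarrow> 'a set" where
  "label i = (if i < 7 then pt i else P)"

lemma bij_label: "bij_betw label {..<8} points"
proof (rule bij_betw_imageI)
  show "inj_on label {..<8}"
  proof (rule inj_onI)
    fix i j :: nat assume "i \<in> {..<8}" "j \<in> {..<8}" "label i = label j"
    then show "i = j"
      using pt_ne[of i] pt_ne[of j] pt_eq_iff[of i j] by (auto simp: label_def cong_def split: if_splits)
  qed
  show "label ` {..<8} = points"
  proof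
    show "label ` {..<8} \<subseteq> points" using pt_points PQ by (auto simp: label_def)
    show "points \<subseteq> label ` {..<8}"
    proof
      fix A assume A: "A \<in> points"
      show "A \<in> label ` {..<8}"
      proof (cases "A = P")
        case True
        then show ?thesis by (intro image_eqI[of _ _ 7]) (auto simp: label_def)
      next
        case False
        then obtain k where "k < 7" "A = pt k" using obtain_pt A by blast
        then show ?thesis by (intro image_eqI[of _ _ k]) (auto simp: label_def)
      qed
    qed
  qed
qed

definition perm :: "'a \<Rightarrow> nat \<Rightarrow> nat" where
  "perm g = restrict (\<lambda>i. the_inv_into {..<8} label (conj_set G g (label i))) {..<8}"

lemma label_points: "i < 8 \<Longrightarrow> label i \<in> points"
  using bij_betwE[OF bij_label] by simp

lemma perm_eqI:
  assumes "g \<in> carrier G" "\<And>i. i < 8 \<Longrightarrow> f i < 8 \<and> conj_set G g (label i) = label (f i)"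
  shows "perm g = restrict f {..<8}"
  unfolding perm_def
proof (rule restrict_ext)
  fix i :: nat assume "i \<in> {..<8}"
  then show "the_inv_into {..<8} label (conj_set G g (label i)) = f i"
    using assms(2)[of i] the_inv_into_f_f[OF bij_betw_imp_inj_on[OF bij_label], of "f i"] by simp
qed

lemma label_perm:
  assumes "g \<in> carrier G" "i < 8"
  shows "perm g i < 8" "label (perm g i) = conj_set G g (label i)"
proof -
  have "conj_set G g (label i) \<in> label ` {..<8}"
    using act_closed[OF assms(1) label_points[OF assms(2)]] bij_betw_imp_surj_on[OF bij_label] by simp
  then show "perm g i < 8" "label (perm g i) = conj_set G g (label i)"
    using the_inv_into_into[OF bij_betw_imp_inj_on[OF bij_label], of "conj_set G g (label i)" "{..<8}"]
      f_the_inv_into_f[OF bij_betw_imp_inj_on[OF bij_label]] assms(2)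
    by (auto simp: perm_def)
qed

lemma perm_hom: "group_hom G (BijGroup {..<8}) perm"
proof -
  let ?f = "\<lambda>g i. the_inv_into {..<8} label (conj_set G g (label i))"
  have inj: "inj_on label {..<8}" using bij_betw_imp_inj_on[OF bij_label] .
  have lt: "?f g i < 8" and lab: "label (?f g i) = conj_set G g (label i)" if "g \<in> carrier G" "i < 8" for g i
    using label_perm[OF that] that(2) by (simp_all add: perm_def)
  have "group_action G {..<8} (\<lambda>g. restrict (?f g) {..<8})"
  proof (rule group_action_restrict)
    show "?f g i \<in> {..<8}" if "g \<in> carrier G" "i \<in> {..<8}" for g i using lt that by simp
    show "?f (g \<otimes> h) i = ?f g (?f h i)" if "g \<in> carrier G" "h \<in> carrier G" "i \<in> {..<8}" for g h i
      using that lab[of h i] act_mult[of g h "label i"] label_points[of i] by simp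
    show "?f \<one> i = i" if "i \<in> {..<8}" for i
      using that act_one[OF label_points[of i]] the_inv_into_f_f[OF inj] by simp
  qed
  then show ?thesis by (simp add: group_action_def perm_def[abs_def])
qed

text \<open>An element acting trivially fixes three points, which \<open>fixer_3\<close> allows only
  for the identity.\<close>

lemma perm_inj: "inj_on perm (carrier G)"
proof (rule inj_onI)
  fix g h assume gh: "g \<in> carrier G" "h \<in> carrier G" "perm g = perm h"
  have fx: "conj_set G (inv h \<otimes> g) (label i) = label i" if "i < 8" for i
    using label_perm(2)[OF gh(1) that] label_perm(2)[OF gh(2) that] gh(3) act_mult[of "inv h" g "label i"]
      act_inv(1)[OF gh(2) label_points[OF that]] label_points[OF that] gh by simp
  have inj: "label i \<noteq> label j" if "i < 8" "j < 8" "i \<noteq> j" for i j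
    using inj_onD[OF bij_betw_imp_inj_on[OF bij_label]] that by auto
  have "inv h \<otimes> g = \<one>"
    using fixer_3[of "label 0" "label 1" "label 2" "inv h \<otimes> g"] gh fx label_points inj by simp
  then have "h \<otimes> (inv h \<otimes> g) = h" using gh by simp
  then show "g = h" using gh by simp
qed

lemma perm_x: "perm x = moebius_translation"
  unfolding moebius_translation_def
proof (rule perm_eqI[OF xG], rule conjI)
  fix i :: nat assume i: "i < 8"
  show "(if i < 7 then (i + 1) mod 7 else 7) < 8" by (simp, presburger)
  have "pt (Suc i) = pt (Suc i mod 7)" by (simp add: pt_eq_iff cong_def)
  then show "conj_set G x (label i) = label (if i < 7 then (i + 1) mod 7 else 7)"
    using x_pt[of i] act_self[OF PQ(1) x(1)] by (simp add: label_def)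
qed

lemma perm_y: "perm y = moebius_dilation"
  unfolding moebius_dilation_def
proof (rule perm_eqI[OF yG], rule conjI)
  fix i :: nat assume i: "i < 8"
  show "(if i < 7 then 2 * i mod 7 else 7) < 8" by (simp, presburger)
  have "pt (2 * i) = pt (2 * i mod 7)" by (simp add: pt_eq_iff cong_def)
  then show "conj_set G y (label i) = label (if i < 7 then 2 * i mod 7 else 7)"
    using y_pt[of i] yP by (simp add: label_def)
qed

lemma perm_t:
  assumes t1: "conj_set G t (pt 1) = pt 6"
  shows "perm t = moebius_inversion"
  unfolding moebius_inversion_def
proof (rule perm_eqI[OF tG])
  \<comment> \<open>From t(1) = 6, doubling gives t(2) = 24 = 3 and t(4) = 12 = 5; the values at 6,
    3 and 5 follow as t is an involution.\<close>
  have red: "pt 24 = pt 3" "pt 12 = pt 5" by (simp_all add: pt_eq_iff cong_def)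
  have t2: "conj_set G t (pt 2) = pt 3" using t_pt[OF t1] red by simp
  have t4: "conj_set G t (pt 4) = pt 5" using t_pt[OF t2] red by simp
  note t6 = t_flip[OF pt_points t1] and t3 = t_flip[OF pt_points t2] and t5 = t_flip[OF pt_points t4]
  fix i :: nat assume "i < 8"
  then consider "i = 0" | "i = 1" | "i = 2" | "i = 3" | "i = 4" | "i = 5" | "i = 6" | "i = 7" by linarith
  then show "[7, 6, 3, 2, 5, 4, 1, 0] ! i < (8::nat) \<and>
      conj_set G t (label i) = label ([7, 6, 3, 2, 5, 4, 1, 0] ! i)"
    using t1 t2 t3 t4 t5 t6 tP tQ pt_0 by cases (simp_all add: label_def)
qed

lemma iso_moebius:
  assumes "conj_set G t (pt 1) = pt 6"
  shows "G \<cong> moebius_group"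
proof -
  interpret h: group_hom G "BijGroup {..<8}" perm using perm_hom .
  have "perm ` carrier G = generate (BijGroup {..<8}) (perm ` {x, y, t})"
    using h.generate_img[of "{x, y, t}"] generate_frame xG yG tG by simp
  then have img: "perm ` carrier G = carrier moebius_group"
    using perm_x perm_y perm_t[OF assms] by (simp add: moebius_group_def)
  have "perm \<in> hom G moebius_group"
    using img h.hom_mult by (intro homI) (auto simp: moebius_group_def)
  then have "perm \<in> iso G moebius_group"
    using img perm_inj by (intro isoI) (simp_all add: bij_betw_def)
  then show ?thesis by (rule is_isoI)
qed

end

section \<open>Existence of translation, dilation and inversion\<close>

context eight_subgroups
begin

text \<open>A generator y of the two-point stabilizer conjugates x to x^j with j^3 = 1 modulo 7, so
  j is 1, 2 or 4. The value 1 is excluded by \<open>not_commute_3_7\<close>, and for 4 the square of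
  y does, since 16 = 2 modulo 7.\<close>

lemma obtain_dilation:
  assumes PQ: "P \<in> points" "Q \<in> points" "P \<noteq> Q" and x: "x \<in> P" "x \<noteq> \<one>"
  obtains y where "y \<in> fixer {P, Q}" "y \<noteq> \<one>" "y \<otimes> x \<otimes> inv y = x [^] (2::nat)"
proof -
  have xG: "x \<in> carrier G" using x PQ point_mem by blast
  have ox: "ord x = 7" using ord_point PQ x by blast
  have S: "subgroup (fixer {P, Q}) G" using fixer_subgroup PQ by simp
  have "fixer {P, Q} \<noteq> {\<one>}" using card_fixer_2[OF PQ] by auto
  then obtain y where y: "y \<in> fixer {P, Q}" "y \<noteq> \<one>" using subgroup.one_closed[OF S] by blast
  have yG: "y \<in> carrier G" and yP: "conj_set G y P = P" using y by (auto simp: fixer_def)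
  have y3: "y [^] (3::nat) = \<one>" using fixer_2_pow_3[OF PQ y(1)] .
  have "y \<otimes> x \<otimes> inv y \<in> conj_set G y P" using x by (simp add: conj_set_def)
  then have "y \<otimes> x \<otimes> inv y \<in> P" using yP by simp
  then obtain j :: nat where j: "j < 7" "y \<otimes> x \<otimes> inv y = x [^] j"
    using point_generated[OF PQ(1) x] by blast
  have conj_x: "y \<otimes> x [^] k \<otimes> inv y = x [^] (j * k)" for k :: nat
    using conj_pow[OF yG xG, of k] j xG by (simp add: nat_pow_pow)
  have yyy: "y \<otimes> y \<otimes> y = \<one>" using y3 yG by (simp add: numeral_3_eq_3)
  have "(y \<otimes> y \<otimes> y) \<otimes> x \<otimes> inv (y \<otimes> y \<otimes> y)
      = y \<otimes> (y \<otimes> (y \<otimes> x \<otimes> inv y) \<otimes> inv y) \<otimes> inv y"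
    using yG xG by (simp add: m_assoc inv_mult_group)
  also have "\<dots> = x [^] (j * (j * j))" using j(2) conj_x by simp
  finally have "x [^] (1::nat) = x [^] (j * (j * j))" using yyy xG by simp
  then have c: "(j * (j * j)) mod 7 = 1"
    using pow_eq_iff_cong[OF xG, of 1 "j * (j * j)"] ox by (simp add: cong_def)
  have j1: "j \<noteq> 1"
  proof
    assume "j = 1"
    then have "y \<otimes> x \<otimes> inv y = x" using j xG by simp
    then have "y \<otimes> x = x \<otimes> y" using yG xG by (metis inv_solve_right' m_closed)
    then show False using not_commute_3_7[OF yG xG y3 y(2) ox] by blast
  qed
  consider "j = 0" | "j = 1" | "j = 2" | "j = 3" | "j = 4" | "j = 5" | "j = 6" using j by linarith
  then have "j = 2 \<or> j = 4" using c j1 by cases auto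
  then show ?thesis
  proof
    assume "j = 2"
    then show ?thesis using that y j by blast
  next
    assume j4: "j = 4"
    have "(y \<otimes> y) \<otimes> x \<otimes> inv (y \<otimes> y) = y \<otimes> (y \<otimes> x \<otimes> inv y) \<otimes> inv y"
      using yG xG by (simp add: m_assoc inv_mult_group)
    also have "\<dots> = x [^] (16::nat)" using j(2) conj_x j4 by simp
    also have "\<dots> = x [^] (2::nat)" using pow_eq_iff_cong[OF xG] ox by (simp add: cong_def)
    finally have "(y \<otimes> y) \<otimes> x \<otimes> inv (y \<otimes> y) = x [^] (2::nat)" .
    moreover have "y \<otimes> y \<noteq> \<one>" using yyy y(2) yG by auto
    moreover have "y \<otimes> y \<in> fixer {P, Q}" using subgroup.m_closed[OF S y(1) y(1)] .
    ultimately show ?thesis using that by blast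
  qed
qed

text \<open>Transitivity and the regular action of Q yield g interchanging P and Q. Its square fixes
  both, so g^6 = 1, and g^3 serves: an odd power still interchanges them.\<close>

lemma obtain_swap:
  assumes PQ: "P \<in> points" "Q \<in> points" "P \<noteq> Q"
  obtains t where "t \<in> carrier G" "t \<otimes> t = \<one>" "conj_set G t P = Q" "conj_set G t Q = P"
proof -
  obtain h where h: "h \<in> carrier G" "conj_set G h P = Q" using transitive[OF PQ(1,2)] .
  have R: "conj_set G h Q \<in> points" using act_closed[OF h(1) PQ(2)] .
  have "conj_set G h Q \<noteq> Q" using act_inj[OF h(1) PQ(1,2)] h(2) PQ(3) by metis
  then obtain b where b: "b \<in> Q" "conj_set G b (conj_set G h Q) = P"
    using obtain_point_action[OF PQ(2) R PQ(1)] PQ(3) by metis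
  have bG: "b \<in> carrier G" using b(1) PQ point_mem by blast
  define g where "g = b \<otimes> h"
  have g: "g \<in> carrier G" "conj_set G g P = Q" "conj_set G g Q = P"
    using bG h b PQ act_self[OF PQ(2) b(1)] by (simp_all add: g_def act_mult)
  have gg: "g \<otimes> g \<in> fixer {P, Q}" using g PQ by (simp add: fixer_def act_mult)
  have "(g \<otimes> g) [^] (3::nat) = \<one>" using fixer_2_pow_3[OF PQ gg] .
  then have "(g \<otimes> g \<otimes> g) \<otimes> (g \<otimes> g \<otimes> g) = \<one>" using g by (simp add: numeral_3_eq_3 m_assoc)
  moreover have "conj_set G (g \<otimes> g \<otimes> g) P = Q" "conj_set G (g \<otimes> g \<otimes> g) Q = P"
    using g PQ by (simp_all add: act_mult)
  ultimately show ?thesis using that[of "g \<otimes> g \<otimes> g"] g by simp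
qed

text \<open>Conjugation by t preserves the stabilizer, whose elements are 1, y and y^2. If it fixed
  y, then t y would have order divisible by 3 and cube t, so \<open>ord_3\<close> would force t = 1.
  Here the absence of elements of order 6 enters.\<close>

lemma swap_inverts:
  assumes PQ: "P \<in> points" "Q \<in> points" "P \<noteq> Q" and y: "y \<in> fixer {P, Q}" "y \<noteq> \<one>"
    and t: "t \<in> carrier G" "t \<otimes> t = \<one>" "conj_set G t P = Q" "conj_set G t Q = P"
  shows "t \<otimes> y = y \<otimes> y \<otimes> t"
proof -
  have yG: "y \<in> carrier G" and yP: "conj_set G y P = P" "conj_set G y Q = Q"
    using y by (auto simp: fixer_def)
  have y3: "y [^] (3::nat) = \<one>" using fixer_2_pow_3[OF PQ y(1)] .
  have yyy: "y \<otimes> (y \<otimes> y) = \<one>" using y3 yG by (simp add: numeral_3_eq_3 m_assoc)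
  have ttc: "t \<otimes> (t \<otimes> a) = a" if "a \<in> carrier G" for a
    using that t by (simp flip: m_assoc)
  have S: "subgroup (fixer {P, Q}) G" using fixer_subgroup PQ by simp
  have "t \<otimes> y \<otimes> t \<in> fixer {P, Q}" using t yG yP PQ by (simp add: fixer_def act_mult)
  moreover have "{\<one>, y, y \<otimes> y} = fixer {P, Q}"
  proof (rule card_subset_eq)
    show "finite (fixer {P, Q})" using finite_subset[OF subgroup.subset[OF S] fin] .
    show "{\<one>, y, y \<otimes> y} \<subseteq> fixer {P, Q}"
      using S y(1) subgroup.one_closed subgroup.m_closed by auto
    have "y \<otimes> y \<noteq> \<one>" using yyy y(2) yG by auto
    moreover have "y \<otimes> y \<noteq> y" using y(2) yG by simp
    ultimately show "card {\<one>, y, y \<otimes> y} = card (fixer {P, Q})"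
      using y(2) card_fixer_2[OF PQ] by auto
  qed
  ultimately consider "t \<otimes> y \<otimes> t = \<one>" | "t \<otimes> y \<otimes> t = y" | "t \<otimes> y \<otimes> t = y \<otimes> y" by blast
  then show ?thesis
  proof cases
    case 1
    then have "t \<otimes> (t \<otimes> y \<otimes> t) \<otimes> t = \<one>" using t by simp
    then have "y = \<one>" using t yG by (simp add: m_assoc ttc)
    then show ?thesis using y by simp
  next
    case 2
    then have "(t \<otimes> y \<otimes> t) \<otimes> t = y \<otimes> t" by simp
    then have comm: "t \<otimes> y = y \<otimes> t" using t yG by (simp add: m_assoc)
    have tyG: "t \<otimes> y \<in> carrier G" using t yG by simp
    have p: "(t \<otimes> y) [^] (n::nat) = t [^] n \<otimes> y [^] n" for n
      using pow_mult_distrib[OF comm t(1) yG] .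
    have t2: "t [^] (2::nat) = \<one>" using t by (simp add: numeral_2_eq_2)
    have "t [^] (6::nat) = \<one>" "t [^] (3::nat) = t"
      using pow_cong[OF t(1) t2, of 6 0] pow_cong[OF t(1) t2, of 3 1] t(1) by (simp_all add: cong_def)
    moreover have "y [^] (6::nat) = \<one>" "y [^] (2::nat) \<noteq> \<one>"
      using pow_cong[OF yG y3, of 6 0] yyy y(2) yG by (auto simp: cong_def numeral_2_eq_2)
    ultimately have six: "(t \<otimes> y) [^] (6::nat) = \<one>" and two: "(t \<otimes> y) [^] (2::nat) \<noteq> \<one>"
      and three: "(t \<otimes> y) [^] (3::nat) = t"
      using p[of 6] p[of 2] p[of 3] t2 y3 t(1) yG by simp_all
    have "ord (t \<otimes> y) dvd 3 * 2" using six pow_eq_id[OF tyG, of 6] by simp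
    moreover have "\<not> ord (t \<otimes> y) dvd 2" using two pow_eq_id[OF tyG, of 2] by simp
    moreover have "prime (3::nat)" by (simp add: prime_nat_numeral_eq)
    ultimately have "3 dvd ord (t \<otimes> y)"
      using prime_imp_coprime[of 3 "ord (t \<otimes> y)"] coprime_dvd_mult_right_iff[of "ord (t \<otimes> y)" 3 2]
      by (auto simp: coprime_commute)
    then have "t = \<one>" using ord_3[OF tyG] three by simp
    then show ?thesis using t(3) act_one[OF PQ(1)] PQ(3) by simp
  next
    case 3
    then have "(t \<otimes> y \<otimes> t) \<otimes> t = y \<otimes> y \<otimes> t" by simp
    then show ?thesis using t yG by (simp add: m_assoc)
  qed
qed

theorem iso_moebius_group: "G \<cong> moebius_group"
proof -
  have "points \<noteq> {}" using card_points unfolding points_def by (metis card.empty zero_neq_numeral)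
  then obtain P where P: "P \<in> points" by blast
  have "points \<noteq> {P}" using card_points by (auto simp: points_def)
  then obtain Q where Q: "Q \<in> points" "P \<noteq> Q" using P by blast
  have "card P = 7" using P by (simp add: points_def)
  then have "P \<noteq> {\<one>}" by auto
  moreover have "\<one> \<in> P" using P subgroup.one_closed by (auto simp: points_def)
  ultimately obtain x where x: "x \<in> P" "x \<noteq> \<one>" by blast
  obtain y where y: "y \<in> fixer {P, Q}" "y \<noteq> \<one>" "y \<otimes> x \<otimes> inv y = x [^] (2::nat)"
    using obtain_dilation[OF P Q x] .
  obtain t where t: "t \<in> carrier G" "t \<otimes> t = \<one>" "conj_set G t P = Q" "conj_set G t Q = P"
    using obtain_swap[OF P Q] .
  interpret F: moebius_frame G P Q x y t
    using P Q x y t swap_inverts[OF P Q y(1,2) t] by unfold_locales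
  obtain s where s: "moebius_frame G P Q x y s" "conj_set G s (F.pt 1) = F.pt 6"
    using F.normalise_frame .
  interpret S: moebius_frame G P Q x y s by fact
  show ?thesis using S.iso_moebius s(2) by simp
qed

end

theorem Exp_rho_imp_iso_moebius:
  assumes "group G" "finite (carrier G)" "Exp_rho G = {48, 56, 105}"
  shows "G \<cong> moebius_group"
proof -
  interpret group G by fact
  interpret eight_subgroups G
    using Exp_rho_imp_subgroups_order_7[OF assms(2,3)] assms(2) by unfold_locales
  show ?thesis by (rule iso_moebius_group)
qed

section \<open>Element orders of PSL(2, 7)\<close>

lemma UNIV_7: "(UNIV :: 7 set) = {0, 1, 2, 3, 4, 5, 6}"
proof -
  have "card {0, 1, 2, 3, 4, 5, 6 :: 7} = CARD(7)" by simp
  then show ?thesis by (metis card_eq_UNIV_imp_eq_UNIV finite)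
qed

lemma sum_7: "(\<Sum>a\<in>UNIV. f (a::7)) = f 0 + f 1 + f 2 + f 3 + f 4 + f 5 + f 6"
  unfolding UNIV_7 by (simp add: add.assoc)

lemma forall_7: "(\<forall>a::7. P a) \<longleftrightarrow> P 0 \<and> P 1 \<and> P 2 \<and> P 3 \<and> P 4 \<and> P 5 \<and> P 6"
proof -
  have "(\<forall>a::7. P a) \<longleftrightarrow> (\<forall>a\<in>UNIV. P a)" by simp
  then show ?thesis unfolding UNIV_7 by simp
qed

text \<open>For e nonzero b may be any unit; for e = 0 there are 7 + 7 - 1 pairs.\<close>

lemma card_product_eq_7: "card {(b, c). b * c = (e::7)} = (if e = 0 then 13 else 6)"
proof -
  have "card {(b, c). b * c = e} = (\<Sum>b\<in>UNIV. \<Sum>c\<in>UNIV. if b * c = e then 1 else 0)"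
  proof -
    have "{(b, c). b * c = e} = (SIGMA b:UNIV. {c. b * c = e})" by auto
    moreover have "card {c. b * c = e} = (\<Sum>c\<in>UNIV. if b * c = e then 1 else 0)" for b
      by (simp add: sum.If_cases)
    ultimately show ?thesis by simp
  qed
  moreover have "\<forall>e::7. (\<Sum>b\<in>UNIV. \<Sum>c\<in>UNIV. if b * c = e then 1 else 0) = (if e = 0 then 13 else (6::nat))"
    unfolding forall_7 sum_7 by simp
  ultimately show ?thesis by simp
qed

definition mat2 :: "'a::zero \<Rightarrow> 'a \<Rightarrow> 'a \<Rightarrow> 'a \<Rightarrow> 'a ^ 2 ^ 2" where
  "mat2 a b c d = vector [vector [a, b], vector [c, d]]"

lemma mat2_nth [simp]:
  "mat2 a b c d $ 1 $ 1 = a" "mat2 a b c d $ 1 $ 2 = b"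
  "mat2 a b c d $ 2 $ 1 = c" "mat2 a b c d $ 2 $ 2 = d"
  by (simp_all add: mat2_def)

text \<open>The diagonal is a and t - a, and determinant 1 prescribes the product of the other two
  entries.\<close>

lemma card_SL_trace:
  "card {A \<in> carrier (SL :: (7 ^ 2 ^ 2) monoid). trace A = t}
    = (\<Sum>a\<in>UNIV. if a * (t - a) - 1 = 0 then 13 else 6)"
proof -
  let ?S = "SIGMA a:UNIV. {(b, c). b * c = a * (t - a) - 1}"
  have "bij_betw (\<lambda>(a, b, c). mat2 a b c (t - a)) ?S {A \<in> carrier (SL :: (7 ^ 2 ^ 2) monoid). trace A = t}"
  proof (rule bij_betwI[where g = "\<lambda>A :: 7 ^ 2 ^ 2. (A $ 1 $ 1, A $ 1 $ 2, A $ 2 $ 1)"])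
    show "(\<lambda>(a, b, c). mat2 a b c (t - a)) \<in> ?S \<rightarrow> {A \<in> carrier SL. trace A = t}"
      by (auto simp: SL_def det_2 trace_def sum_2)
    show "(\<lambda>A :: 7 ^ 2 ^ 2. (A $ 1 $ 1, A $ 1 $ 2, A $ 2 $ 1)) \<in> {A \<in> carrier SL. trace A = t} \<rightarrow> ?S"
      by (auto simp: SL_def det_2 trace_def sum_2 algebra_simps)
    show "(\<lambda>(a, b, c). mat2 a b c (t - a)) (A $ 1 $ 1, A $ 1 $ 2, A $ 2 $ 1) = A"
      if "A \<in> {A \<in> carrier SL. trace A = t}" for A :: "7 ^ 2 ^ 2"
      using that by (auto simp: trace_def sum_2 vec_eq_iff forall_2)
  qed auto
  then have "card {A \<in> carrier (SL :: (7 ^ 2 ^ 2) monoid). trace A = t} = card ?S"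
    by (simp add: bij_betw_same_card)
  also have "\<dots> = (\<Sum>a\<in>UNIV. card {(b, c). b * c = a * (t - a) - 1})"
    by (intro card_SigmaI) auto
  finally show ?thesis by (simp add: card_product_eq_7)
qed

text \<open>Each value is 42 plus 7 for every root a of a (t - a) = 1 modulo 7. They add up to 336,
  the order of SL(2,7).\<close>

lemma card_SL_trace_values:
  "card {A \<in> carrier (SL :: (7 ^ 2 ^ 2) monoid). trace A = 0} = 42"
  "card {A \<in> carrier (SL :: (7 ^ 2 ^ 2) monoid). trace A = 1} = 56"
  "card {A \<in> carrier (SL :: (7 ^ 2 ^ 2) monoid). trace A = 2} = 49"
  "card {A \<in> carrier (SL :: (7 ^ 2 ^ 2) monoid). trace A = 3} = 42"
  "card {A \<in> carrier (SL :: (7 ^ 2 ^ 2) monoid). trace A = 4} = 42"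
  "card {A \<in> carrier (SL :: (7 ^ 2 ^ 2) monoid). trace A = 5} = 49"
  "card {A \<in> carrier (SL :: (7 ^ 2 ^ 2) monoid). trace A = 6} = 56"
  unfolding card_SL_trace sum_7 by simp_all

section \<open>Powers and center of the special linear group\<close>

lemma group_SL: "group (SL :: ('a::comm_ring_1 ^ 2 ^ 2) monoid)"
proof (rule groupI)
  fix A :: "'a ^ 2 ^ 2"
  assume "A \<in> carrier SL"
  then have d: "A $ 1 $ 1 * A $ 2 $ 2 - A $ 1 $ 2 * A $ 2 $ 1 = 1" by (simp add: SL_def det_2)
  \<comment> \<open>The adjugate, which inverts a matrix of determinant 1 over any commutative
    ring.\<close>
  let ?B = "mat2 (A $ 2 $ 2) (- (A $ 1 $ 2)) (- (A $ 2 $ 1)) (A $ 1 $ 1)"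
  have "?B ** A = mat 1"
    using d by (simp add: vec_eq_iff forall_2 matrix_matrix_mult_def sum_2 mat_def algebra_simps)
  moreover have "det ?B = 1" using d by (simp add: det_2 algebra_simps)
  ultimately show "\<exists>B\<in>carrier SL. B \<otimes>\<^bsub>SL\<^esub> A = \<one>\<^bsub>SL\<^esub>" by (auto simp: SL_def)
qed (auto simp: SL_def det_mul matrix_mul_assoc)

definition scalar_combination :: "'a \<Rightarrow> 'a \<Rightarrow> 'a ^ 2 ^ 2 \<Rightarrow> ('a::comm_ring_1) ^ 2 ^ 2" where
  "scalar_combination p q A = mat2 (p * A $ 1 $ 1 + q) (p * A $ 1 $ 2) (p * A $ 2 $ 1) (p * A $ 2 $ 2 + q)"

text \<open>The Cayley--Hamilton relation \<open>A\<^sup>2 = tr A \<cdot> A - 1\<close> for \<open>det A = 1\<close>.\<close>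

lemma scalar_combination_mult:
  assumes "det A = 1"
  shows "scalar_combination p q A ** A = scalar_combination (p * trace A + q) (- p) (A :: 'a::comm_ring_1 ^ 2 ^ 2)"
proof -
  have d: "A $ 1 $ 2 * A $ 2 $ 1 = A $ 1 $ 1 * A $ 2 $ 2 - 1"
    using assms by (simp add: det_2 algebra_simps)
  have d': "p * (A $ 1 $ 2 * A $ 2 $ 1) = p * (A $ 1 $ 1 * A $ 2 $ 2) - p" unfolding d by (simp add: algebra_simps)
  show ?thesis
    using d' by (simp add: scalar_combination_def vec_eq_iff forall_2 matrix_matrix_mult_def sum_2 trace_def algebra_simps)
qed

text \<open>The n-th power of A reduced to the form p A + q by Cayley-Hamilton. The coefficients
  depend on A only through its trace t, so all matrices of equal trace are handled at once.\<close>

primrec power_coeffs :: "'a \<Rightarrow> nat \<Rightarrow> 'a \<times> ('a::comm_ring_1)" where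
  "power_coeffs t 0 = (0, 1)"
| "power_coeffs t (Suc n) = (case power_coeffs t n of (p, q) \<Rightarrow> (p * t + q, - p))"

lemma SL_pow:
  assumes "A \<in> carrier SL"
  shows "A [^]\<^bsub>SL\<^esub> n = (case power_coeffs (trace A) n of (p, q) \<Rightarrow> scalar_combination p q (A :: 'a::comm_ring_1 ^ 2 ^ 2))"
proof (induction n)
  case 0
  have "scalar_combination 0 1 A = mat 1"
    by (simp add: scalar_combination_def vec_eq_iff forall_2 mat_def)
  then show ?case by (simp add: SL_def)
next
  case (Suc n)
  have "A [^]\<^bsub>SL\<^esub> Suc n = A [^]\<^bsub>SL\<^esub> n ** A" by (simp add: SL_def)
  then show ?case using Suc.IH scalar_combination_mult[of A] assms
    by (simp add: SL_def split: prod.split)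
qed

lemma center_SL_7: "group_center (SL :: (7 ^ 2 ^ 2) monoid) = {mat2 1 0 0 1, mat2 6 0 0 6}"
proof
  show "group_center (SL :: (7 ^ 2 ^ 2) monoid) \<subseteq> {mat2 1 0 0 1, mat2 6 0 0 6}"
  proof
    fix A :: "7 ^ 2 ^ 2" assume A: "A \<in> group_center SL"
    then have d: "A $ 1 $ 1 * A $ 2 $ 2 - A $ 1 $ 2 * A $ 2 $ 1 = 1"
      by (simp add: group_center_def SL_def det_2)
    \<comment> \<open>Commuting with these two elementary matrices makes A scalar, and 1 and 6 are
      the only square roots of 1 modulo 7.\<close>
    have "mat2 1 1 0 1 \<in> carrier (SL :: (7 ^ 2 ^ 2) monoid)" "mat2 1 0 1 1 \<in> carrier (SL :: (7 ^ 2 ^ 2) monoid)"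
      by (simp_all add: SL_def det_2)
    then have "A ** mat2 1 1 0 1 = mat2 1 1 0 1 ** A" "A ** mat2 1 0 1 1 = mat2 1 0 1 1 ** A"
      using A by (auto simp: group_center_def SL_def)
    then have e: "A $ 2 $ 1 = 0" "A $ 1 $ 2 = 0" "A $ 1 $ 1 = A $ 2 $ 2"
      by (simp_all add: vec_eq_iff forall_2 matrix_matrix_mult_def sum_2)
    then have "A $ 1 $ 1 * A $ 1 $ 1 = 1" using d by simp
    moreover have "\<forall>a::7. a * a = 1 \<longrightarrow> a = 1 \<or> a = 6" unfolding forall_7 by simp
    ultimately have "A $ 1 $ 1 = 1 \<or> A $ 1 $ 1 = 6" by blast
    then have "mat2 (A $ 1 $ 1) 0 0 (A $ 1 $ 1) \<in> {mat2 1 0 0 1, mat2 6 0 0 6}" by auto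
    moreover have "mat2 (A $ 1 $ 1) 0 0 (A $ 1 $ 1) = A" using e by (simp add: vec_eq_iff forall_2)
    ultimately show "A \<in> {mat2 1 0 0 1, mat2 6 0 0 6}" by simp
  qed
  show "{mat2 1 0 0 1, mat2 6 0 0 6} \<subseteq> group_center (SL :: (7 ^ 2 ^ 2) monoid)"
    by (auto simp: group_center_def SL_def det_2 vec_eq_iff forall_2 matrix_matrix_mult_def sum_2)
qed

lemma (in group) center_normal: "group_center G \<lhd> G"
proof -
  have iff: "a \<in> group_center G \<longleftrightarrow> a \<in> carrier G \<and> (\<forall>g\<in>carrier G. a \<otimes> g = g \<otimes> a)" for a
    by (simp add: group_center_def)
  have sub: "subgroup (group_center G) G"
  proof
    show "group_center G \<subseteq> carrier G" "\<one> \<in> group_center G" unfolding iff by (auto simp: iff)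
    fix a b assume ab: "a \<in> group_center G" "b \<in> group_center G"
    then have G: "a \<in> carrier G" "b \<in> carrier G" unfolding iff by auto
    have "a \<otimes> b \<otimes> g = g \<otimes> (a \<otimes> b)" if g: "g \<in> carrier G" for g
    proof -
      have bg: "b \<otimes> g = g \<otimes> b" and ag: "a \<otimes> g = g \<otimes> a" using ab g unfolding iff by auto
      have "a \<otimes> b \<otimes> g = a \<otimes> (b \<otimes> g)" using G g by (rule_tac m_assoc)
      also have "\<dots> = (a \<otimes> g) \<otimes> b" unfolding bg using G g by (simp add: m_assoc)
      also have "\<dots> = g \<otimes> (a \<otimes> b)" unfolding ag using G g by (simp add: m_assoc)
      finally show ?thesis .
    qed
    then show "a \<otimes> b \<in> group_center G" using G unfolding iff by blast
  next
    fix a assume a: "a \<in> group_center G"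
    then have aG: "a \<in> carrier G" unfolding iff by blast
    have "inv a \<otimes> g = g \<otimes> inv a" if g: "g \<in> carrier G" for g
    proof -
      have "g \<otimes> a = a \<otimes> g" using a g unfolding iff by metis
      then show ?thesis using commute_inv[OF g aG] by metis
    qed
    then show "inv a \<in> group_center G" using aG unfolding iff by blast
  qed
  show ?thesis
  proof (rule normal_invI[OF sub])
    fix g h assume g: "g \<in> carrier G" and h: "h \<in> group_center G"
    then have hG: "h \<in> carrier G" and comm: "h \<otimes> g = g \<otimes> h" unfolding iff by auto
    have "g \<otimes> h \<otimes> inv g = h" unfolding comm[symmetric] using g hG by (simp add: m_assoc)
    then show "g \<otimes> h \<otimes> inv g \<in> group_center G" using h by simp
  qed
qed

lemma group_PSL_2_7: "group PSL_2_7"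
  unfolding PSL_2_7_def PSL_def
  by (rule normal.factorgroup_is_group[OF group.center_normal[OF group_SL]])

lemma exponent_set_2_3_7:
  assumes "a > 0" "b > 0" "c > 0"
  shows "exponent_set (2 ^ a * 3 ^ b * 7 ^ c) = {a, b, c}"
proof -
  let ?n = "2 ^ a * 3 ^ b * 7 ^ c :: nat"
  have p: "prime (2::nat)" "prime (3::nat)" "prime (7::nat)" by (simp_all add: prime_nat_numeral_eq)
  have "prime_factorization ?n = replicate_mset a 2 + replicate_mset b 3 + replicate_mset c 7"
    using p by (simp add: prime_factorization_mult prime_factorization_prime_power)
  then have pf: "prime_factors ?n = {2, 3, 7}"
    and ct: "count (prime_factorization ?n) 2 = a" "count (prime_factorization ?n) 3 = b"
      "count (prime_factorization ?n) 7 = c"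
    using assms by (auto simp: set_mset_replicate_mset_subset)
  have "multiplicity 2 ?n = a" "multiplicity 3 ?n = b" "multiplicity 7 ?n = c"
    using ct p by (simp_all only: count_prime_factorization_prime)
  then show ?thesis unfolding exponent_set_def pf by simp
qed

section \<open>Element orders in the quotient by the center\<close>

abbreviation SL_2_7 :: "(7 ^ 2 ^ 2) monoid" where "SL_2_7 \<equiv> SL"

abbreviation center_coset :: "7 ^ 2 ^ 2 \<Rightarrow> (7 ^ 2 ^ 2) set" where
  "center_coset A \<equiv> group_center SL_2_7 #>\<^bsub>SL_2_7\<^esub> A"

interpretation SL: group SL_2_7 by (rule group_SL)
interpretation PSL: group PSL_2_7 by (rule group_PSL_2_7)

lemma center_normal_SL: "group_center SL_2_7 \<lhd> SL_2_7"
  by (rule SL.center_normal)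

lemma center_subgroup: "subgroup (group_center SL_2_7) SL_2_7"
  using center_normal_SL normal_imp_subgroup by blast

lemma carrier_PSL: "carrier PSL_2_7 = rcosets\<^bsub>SL_2_7\<^esub> (group_center SL_2_7)"
  by (simp add: PSL_2_7_def PSL_def FactGroup_def)

lemma finite_SL: "finite (carrier SL_2_7)" by (rule finite)

lemma finite_PSL: "finite (carrier PSL_2_7)" by (rule finite)

lemma center_coset_closed:
  "A \<in> carrier SL_2_7 \<Longrightarrow> center_coset A \<in> carrier PSL_2_7"
  unfolding carrier_PSL using SL.rcosetsI subgroup.subset[OF center_subgroup] by blast

lemma center_coset_pow_iff:
  assumes "A \<in> carrier SL_2_7"
  shows "PSL.ord (center_coset A) dvd n \<longleftrightarrow> A [^]\<^bsub>SL_2_7\<^esub> n \<in> group_center SL_2_7"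
proof -
  have An: "A [^]\<^bsub>SL_2_7\<^esub> n \<in> carrier SL_2_7" using assms by simp
  have "center_coset A [^]\<^bsub>PSL_2_7\<^esub> n = center_coset (A [^]\<^bsub>SL_2_7\<^esub> n)"
    unfolding PSL_2_7_def PSL_def by (rule normal.FactGroup_pow[OF center_normal_SL assms])
  moreover have "\<one>\<^bsub>PSL_2_7\<^esub> = group_center SL_2_7"
    by (simp add: PSL_2_7_def PSL_def FactGroup_def)
  moreover have "center_coset (A [^]\<^bsub>SL_2_7\<^esub> n) = group_center SL_2_7
      \<longleftrightarrow> A [^]\<^bsub>SL_2_7\<^esub> n \<in> group_center SL_2_7"
    using SL.coset_join1[OF _ An center_subgroup]
      SL.coset_join2[OF An center_subgroup] by blast
  ultimately show ?thesis
    using PSL.pow_eq_id[OF center_coset_closed[OF assms], of n] by simp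
qed

lemma trace_scalar_combination: "trace (scalar_combination p q A) = p * trace A + 2 * (q::7)"
  by (simp add: scalar_combination_def trace_def sum_2 algebra_simps)

lemma center_trace: "A \<in> group_center SL_2_7 \<Longrightarrow> trace A = 2 \<or> trace A = 5"
  by (auto simp: center_SL_7 trace_def sum_2)

lemma scalar_combination_center: "q = 1 \<or> q = 6 \<Longrightarrow> scalar_combination 0 q A \<in> group_center SL_2_7"
  by (auto simp: center_SL_7 scalar_combination_def)

lemma center_coset_ord_prime:
  assumes "A \<in> carrier SL_2_7" "A \<notin> group_center SL_2_7" "prime p"
    and "power_coeffs (trace A) p = (0, q)" "q = 1 \<or> q = 6"
  shows "PSL.ord (center_coset A) = p"
proof -
  have "A [^]\<^bsub>SL_2_7\<^esub> p \<in> group_center SL_2_7"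
    using SL_pow[OF assms(1), of p] scalar_combination_center[OF assms(5)] assms(4) by simp
  then have "PSL.ord (center_coset A) dvd p" using center_coset_pow_iff[OF assms(1)] by blast
  moreover have "\<not> PSL.ord (center_coset A) dvd 1"
    using center_coset_pow_iff[OF assms(1), of 1] assms(1,2) by simp
  ultimately show ?thesis using assms(3) prime_nat_iff by (metis dvd_refl)
qed

text \<open>Both traces satisfy t^2 = 2 modulo 7. So the square of A has trace t^2 - 2 = 0 and is
  not central, while the fourth power is -1.\<close>

lemma center_coset_ord_4:
  assumes A: "A \<in> carrier SL_2_7" "trace A = 3 \<or> trace A = 4"
  shows "PSL.ord (center_coset A) = 4"
proof -
  have c4: "power_coeffs (trace A) 4 = (0, 6)" and c2: "power_coeffs (trace A) 2 = (trace A, 6)"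
    using A(2) by (auto simp: eval_nat_numeral)
  have "A [^]\<^bsub>SL_2_7\<^esub> (4::nat) \<in> group_center SL_2_7"
    using SL_pow[OF A(1), of 4] scalar_combination_center[of 6 A] c4 by simp
  then have "PSL.ord (center_coset A) dvd 2 ^ 2" using center_coset_pow_iff[OF A(1), of 4] by simp
  then obtain i where i: "i \<le> 2" "PSL.ord (center_coset A) = 2 ^ i"
    using divides_primepow_nat[OF two_is_prime_nat] by blast
  have "trace (A [^]\<^bsub>SL_2_7\<^esub> (2::nat)) = 0"
    using SL_pow[OF A(1), of 2] c2 A(2) by (auto simp: trace_scalar_combination)
  then have "A [^]\<^bsub>SL_2_7\<^esub> (2::nat) \<notin> group_center SL_2_7" using center_trace by force
  then have "\<not> PSL.ord (center_coset A) dvd 2" using center_coset_pow_iff[OF A(1), of 2] by simp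
  moreover have "i = 0 \<or> i = 1 \<or> i = 2" using i(1) by linarith
  ultimately show ?thesis using i(2) by auto
qed

lemma center_coset_ord_1:
  assumes "A \<in> group_center SL_2_7"
  shows "PSL.ord (center_coset A) = 1"
proof -
  have A: "A \<in> carrier SL_2_7" using assms subgroup.mem_carrier[OF center_subgroup] by blast
  then show ?thesis using center_coset_pow_iff[OF A, of 1] assms by simp
qed

text \<open>The order of the coset is 2 for trace 0, 3 for traces 1 and 6, 4 for traces 3 and 4, and
  7 for traces 2 and 5. The exceptions are the central matrices 1 and -1, of traces 2 and 5, which
  contribute a factor 1; hence 48 in place of 49.\<close>

lemma prod_coset_ord_trace:
  "(\<Prod>A\<in>{A \<in> carrier SL_2_7. trace A = 0}. PSL.ord (center_coset A)) = 2 ^ 42"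
  "(\<Prod>A\<in>{A \<in> carrier SL_2_7. trace A = 1}. PSL.ord (center_coset A)) = 3 ^ 56"
  "(\<Prod>A\<in>{A \<in> carrier SL_2_7. trace A = 2}. PSL.ord (center_coset A)) = 7 ^ 48"
  "(\<Prod>A\<in>{A \<in> carrier SL_2_7. trace A = 3}. PSL.ord (center_coset A)) = 4 ^ 42"
  "(\<Prod>A\<in>{A \<in> carrier SL_2_7. trace A = 4}. PSL.ord (center_coset A)) = 4 ^ 42"
  "(\<Prod>A\<in>{A \<in> carrier SL_2_7. trace A = 5}. PSL.ord (center_coset A)) = 7 ^ 48"
  "(\<Prod>A\<in>{A \<in> carrier SL_2_7. trace A = 6}. PSL.ord (center_coset A)) = 3 ^ 56"
proof -
  let ?f = "\<lambda>A. PSL.ord (center_coset A)"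
  let ?S = "\<lambda>t. {A \<in> carrier SL_2_7. trace A = t}"
  have const: "prod ?f (?S t) = k ^ card (?S t)" if "\<And>A. A \<in> ?S t \<Longrightarrow> ?f A = k" for t k
    using that by simp
  have p: "prime (3::nat)" "prime (7::nat)" by (simp_all add: prime_nat_numeral_eq)
  \<comment> \<open>In terms of matrices: A^2 = -1 for trace 0, A^3 = -1 and 1 for traces 1 and 6,
    A^7 = 1 and -1 for traces 2 and 5.\<close>
  have co: "power_coeffs (0::7) 2 = (0, 6)" "power_coeffs (1::7) 3 = (0, 6)" "power_coeffs (6::7) 3 = (0, 1)"
    "power_coeffs (2::7) 7 = (0, 1)" "power_coeffs (5::7) 7 = (0, 6)"
    by (simp_all add: eval_nat_numeral)
  have nc: "A \<notin> group_center SL_2_7" if "trace A \<in> {0, 1, 6}" for A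
    using that center_trace[of A] by auto
  show "prod ?f (?S 0) = 2 ^ 42"
    using const[of 0 2] center_coset_ord_prime[OF _ nc two_is_prime_nat] co(1) card_SL_trace_values(1) by simp
  show "prod ?f (?S 1) = 3 ^ 56"
    using const[of 1 3] center_coset_ord_prime[OF _ nc p(1)] co(2) card_SL_trace_values(2) by simp
  show "prod ?f (?S 6) = 3 ^ 56"
    using const[of 6 3] center_coset_ord_prime[OF _ nc p(1)] co(3) card_SL_trace_values(7) by simp
  show "prod ?f (?S 3) = 4 ^ 42"
    using const[of 3 4] center_coset_ord_4 card_SL_trace_values(4) by simp
  show "prod ?f (?S 4) = 4 ^ 42"
    using const[of 4 4] center_coset_ord_4 card_SL_trace_values(5) by simp
  have unip: "prod ?f (?S t) = 7 ^ 48"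
    if t: "card (?S t) = 49" "power_coeffs t 7 = (0, q)" "q = 1 \<or> q = 6" "?S t \<inter> group_center SL_2_7 = {I}" for t q I
  proof -
    have "prod ?f (?S t) = ?f I * prod ?f (?S t - {I})"
      using t(4) by (intro prod.remove) (auto intro: finite)
    also have "?f I = 1" using center_coset_ord_1[of I] t(4) by blast
    also have "prod ?f (?S t - {I}) = prod (\<lambda>_. 7) (?S t - {I})"
    proof (rule prod.cong[OF refl])
      fix A assume A: "A \<in> ?S t - {I}"
      then have "A \<notin> group_center SL_2_7" using t(4) by blast
      then show "?f A = 7" using center_coset_ord_prime[OF _ _ p(2)] A t(2,3) by simp
    qed
    also have "card (?S t - {I}) = 48" using t(1,4) by (subst card_Diff_singleton) auto
    then have "prod (\<lambda>_. 7::nat) (?S t - {I}) = 7 ^ 48" by simp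
    finally show ?thesis by simp
  qed
  have Z: "?S 2 \<inter> group_center SL_2_7 = {mat2 1 0 0 1}" "?S 5 \<inter> group_center SL_2_7 = {mat2 6 0 0 6}"
    unfolding center_SL_7 by (auto simp: SL_def det_2 trace_def sum_2)
  show "prod ?f (?S 2) = 7 ^ 48" using unip[OF card_SL_trace_values(3) co(4) _ Z(1)] by simp
  show "prod ?f (?S 5) = 7 ^ 48" using unip[OF card_SL_trace_values(6) co(5) _ Z(2)] by simp
qed

text \<open>Every coset of the center has two elements, so the product over SL(2,7) is the square of
  the wanted one. Its exponents are 42 + 4 * 42 = 210, 2 * 56 and 2 * 48.\<close>

lemma order_product_PSL: "order_product PSL_2_7 = 2 ^ 105 * 3 ^ 56 * 7 ^ 48"
proof -
  let ?f = "\<lambda>A. PSL.ord (center_coset A)"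
  let ?N = "2 ^ 105 * 3 ^ 56 * 7 ^ 48 :: nat"
  have "(\<Prod>K\<in>carrier PSL_2_7. PSL.ord K ^ 2) =
      (\<Prod>K\<in>carrier PSL_2_7. \<Prod>A\<in>{A \<in> carrier SL_2_7. center_coset A = K}. ?f A)"
  proof (rule prod.cong[OF refl])
    fix K assume "K \<in> carrier PSL_2_7"
    then obtain B where B: "B \<in> carrier SL_2_7" "K = center_coset B"
      by (auto simp: carrier_PSL RCOSETS_def)
    have KS: "K \<subseteq> carrier SL_2_7"
      using SL.r_coset_subset_G[OF subgroup.subset[OF center_subgroup] B(1)] B(2) by simp
    have "{A \<in> carrier SL_2_7. center_coset A = K} = K"
      using SL.rcos_self[OF _ center_subgroup] SL.repr_independence[OF _ B(1) center_subgroup] KS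
      unfolding B(2) by blast
    moreover have "card K = card (group_center SL_2_7)"
      using SL.card_rcosets_equal[of K "group_center SL_2_7"] \<open>K \<in> carrier PSL_2_7\<close>
        subgroup.subset[OF center_subgroup] by (simp add: carrier_PSL)
    moreover have "card (group_center SL_2_7) = 2"
    proof -
      have "mat2 1 0 0 1 $ 1 $ 1 \<noteq> (mat2 6 0 0 6 $ 1 $ 1 :: 7)" by simp
      then have "mat2 1 0 0 1 \<noteq> (mat2 6 0 0 6 :: 7 ^ 2 ^ 2)" by metis
      then show ?thesis by (simp add: center_SL_7)
    qed
    moreover have "(\<Prod>A\<in>{A \<in> carrier SL_2_7. center_coset A = K}. ?f A) =
        (\<Prod>A\<in>{A \<in> carrier SL_2_7. center_coset A = K}. PSL.ord K)"
      by (rule prod.cong) auto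
    ultimately show "PSL.ord K ^ 2 = (\<Prod>A\<in>{A \<in> carrier SL_2_7. center_coset A = K}. ?f A)"
      by simp
  qed
  also have "\<dots> = (\<Prod>A\<in>carrier SL_2_7. ?f A)"
    using center_coset_closed by (intro prod.group finite_SL finite_PSL) auto
  also have "\<dots> = (\<Prod>t\<in>UNIV. \<Prod>A\<in>{A \<in> carrier SL_2_7. trace A = t}. ?f A)"
    by (rule prod.group[symmetric]) (auto intro: finite)
  also have "\<dots> = 2 ^ 42 * (3 ^ 56 * (7 ^ 48 * (4 ^ 42 * (4 ^ 42 * (7 ^ 48 * 3 ^ 56)))))"
    unfolding UNIV_7 by (simp add: prod_coset_ord_trace del: power_numeral power_numeral_even power_numeral_odd)
  also have "\<dots> = ?N ^ 2"
    by simp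
  finally have "order_product PSL_2_7 ^ 2 = ?N ^ 2"
    by (simp add: order_product_def prod_power_distrib del: power_numeral)
  then show ?thesis by (simp only: power2_eq_iff_nonneg zero_le)
qed

theorem Exp_rho_PSL_2_7: "Exp_rho PSL_2_7 = {48, 56, 105}"
  using exponent_set_2_3_7[of 105 56 48] by (auto simp: Exp_rho_def order_product_PSL)

section \<open>The characterization\<close>

lemma iso_order_product:
  assumes "group G" "group H" "G \<cong> H"
  shows "order_product G = order_product H"
proof -
  obtain h where h: "h \<in> hom G H" "bij_betw h (carrier G) (carrier H)"
    using assms(3) by (auto simp: is_iso_def iso_def)
  interpret G: group G by fact
  interpret H: group H by fact
  interpret group_hom G H h using h(1) by unfold_locales
  have "H.ord (h g) = G.ord g" if g: "g \<in> carrier G" for g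
  proof -
    have "h g [^]\<^bsub>H\<^esub> n = \<one>\<^bsub>H\<^esub> \<longleftrightarrow> G.ord g dvd n" for n :: nat
    proof -
      have "h g [^]\<^bsub>H\<^esub> n = \<one>\<^bsub>H\<^esub> \<longleftrightarrow> h (g [^]\<^bsub>G\<^esub> n) = h \<one>\<^bsub>G\<^esub>"
        using g hom_nat_pow[OF g, of n] by simp
      also have "\<dots> \<longleftrightarrow> g [^]\<^bsub>G\<^esub> n = \<one>\<^bsub>G\<^esub>"
        using inj_on_eq_iff[OF bij_betw_imp_inj_on[OF h(2)]] g by blast
      finally show ?thesis using G.pow_eq_id[OF g] by simp
    qed
    then show ?thesis using H.ord_unique[OF hom_closed[OF g]] by blast
  qed
  then have "order_product G = (\<Prod>g\<in>carrier G. H.ord (h g))"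
    by (simp add: order_product_def)
  then show ?thesis
    unfolding order_product_def using prod.reindex_bij_betw[OF h(2)] by simp
qed

theorem theorem2p10:
  fixes G :: "('a, 'b) monoid_scheme"
  assumes "group G" and "finite (carrier G)"
  shows "G \<cong> PSL_2_7 \<longleftrightarrow> Exp_rho G = Exp_rho PSL_2_7"
proof
  assume "G \<cong> PSL_2_7"
  then show "Exp_rho G = Exp_rho PSL_2_7"
    using iso_order_product[OF assms(1) group_PSL_2_7] by (simp add: Exp_rho_def)
next
  assume "Exp_rho G = Exp_rho PSL_2_7"
  then have "G \<cong> moebius_group"
    using Exp_rho_imp_iso_moebius[OF assms] Exp_rho_PSL_2_7 by simp
  \<comment> \<open>The matrix group itself satisfies the hypothesis on the exponents, so it is
    identified with the model in the same way.\<close>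
  moreover have "PSL_2_7 \<cong> moebius_group"
    using Exp_rho_imp_iso_moebius[OF group_PSL_2_7 finite_PSL] Exp_rho_PSL_2_7 by simp
  then have "moebius_group \<cong> PSL_2_7"
    using group.iso_sym[OF group_PSL_2_7] by blast
  ultimately show "G \<cong> PSL_2_7" by (rule iso_trans)
qed

end
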